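(* There is an equivariant map $$T:\mathcal{J}\ni a\mapsto T_a\in\mathrm{Hom}_k(\mathcal{J}\otimes\mathcal{J}\otimes\mathcal{J},k)$$ defined by homogeneous polynomials of degree $6$ with the following property. Let $a\in\mathcal{J}$ with $\det(a)\neq0$, and for $X,Y\in\mathcal{J}$ let $X\circ_aY\in\mathcal{J}$ be the element such that $Q_a(X\circ_aY,Z)=\det(a)^{-1}T_a(X,Y,Z)$ for all $Z\in\mathcal{J}$. Then this product structure coincides with that of the isotope $\mathcal{J}_a$, i.e. $X\circ_aY=\det(a)^{-4}\Phi_a(X,Y)$ for all $X,Y\in\mathcal{J}$.
   Context: Let $k$ be a field of characteristic not equal to $2,3$. Let $\mathbb{O}$ be an octonion algebra over $k$ (an 8-dimensional unital composition algebra), with norm $\|x\|$ (a quadratic form with $\|xy\|=\|x\|\|y\|$), conjugation $x\mapsto\overline{x}$ (so $x\overline{x}=\|x\|$) and trace $\mathrm{tr}(x)=x+\overline{x}\in k$. Let $\mathcal{J}$ be the exceptional Jordan algebra over $k$, consisting of the matrices $$X=\begin{pmatrix} s_1&x_3&\overline{x_2}\\ \overline{x_3}&s_2&x_1\\ x_2&\overline{x_1}&s_3\end{pmatrix},\quad s_i\in k,\ x_i\in\mathbb{O},$$ with product $X\circ Y=\frac12(XY+YX)$ (matrix multiplication on the right), $\mathrm{Tr}(X)=s_1+s_2+s_3$, $\langle X,Y\rangle=\mathrm{Tr}(X\circ Y)$, and $\det(X)=s_1s_2s_3+\mathrm{tr}(x_1x_2x_3)-\sum_{i}s_i\|x_i\|$.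 $D$ is the symmetric trilinear form on $\mathcal{J}$ with $6D(X,Y,Z)=\det(X+Y+Z)-\det(X+Y)-\det(Y+Z)-\det(Z+X)+\det(X)+\det(Y)+\det(Z)$. The cross product $X\times Y\in\mathcal{J}$ is defined by $\langle X\times Y,Z\rangle=3D(X,Y,Z)$ for all $Z\in\mathcal{J}$. $GE_6$ is the algebraic group of $L\in\mathrm{GL}(\mathcal{J})$ for which there is a scalar $c(L)\in\mathrm{GL}(1)$ with $\det(LX)=c(L)\det(X)$ for all $X\in\mathcal{J}$. "Equivariant" means that there is a character $\psi$ of $GE_6$ such that $T_{ga}(gX,gY,gZ)=\psi(g)T_a(X,Y,Z)$ for all $g\in GE_6$ and $a,X,Y,Z\in\mathcal{J}$ (also after extension of scalars). For $a\in\mathcal{J}$ put $$Q_a(X,Y)=-6\det(a)D(X,Y,a)+9D(X,a,a)D(Y,a,a),$$ $$\Phi_a(X,Y)=4\det(a)^3(X\times a)\times(Y\times a)+\tfrac12\bigl(\det(a)^2Q_a(X,Y)-Q_a(X,a)Q_a(Y,a)\bigr)a.$$ $Q_a$ is a symmetric bilinear form, non-degenerate when $\det(a)\neq0$. For $\det(a)\ne0$, the isotope $\mathcal{J}_a$ is the vector space $\mathcal{J}$ with product $(X,Y)\mapsto\det(a)^{-4}\Phi_a(X,Y)$. *)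

theory Defs
  imports "HOL-Analysis.Analysis" "HOL-Library.Poly_Mapping"
begin

section \<open>Octonion algebras\<close>

text \<open>
  An 8-dimensional algebra with a quadratic form is carried by the coordinate space of
  dimension 8; choosing a basis brings every 8-dimensional algebra into this form.
\<close>

record 'r oct =
  oct_mult :: "'r ^ 8 \<Rightarrow> 'r ^ 8 \<Rightarrow> 'r ^ 8"
  oct_one :: "'r ^ 8"
  oct_norm :: "'r ^ 8 \<Rightarrow> 'r"

definition oct_polar :: "('r :: comm_ring_1) oct \<Rightarrow> 'r ^ 8 \<Rightarrow> 'r ^ 8 \<Rightarrow> 'r" where
  "oct_polar A x y = oct_norm A (x + y) - oct_norm A x - oct_norm A y"

text \<open>The trace as a scalar; as an element of the algebra it is \<open>x + oct_cnj A x\<close>.\<close>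

definition oct_tr :: "('r :: comm_ring_1) oct \<Rightarrow> 'r ^ 8 \<Rightarrow> 'r" where
  "oct_tr A x = oct_polar A x (oct_one A)"

definition oct_cnj :: "('r :: comm_ring_1) oct \<Rightarrow> 'r ^ 8 \<Rightarrow> 'r ^ 8" where
  "oct_cnj A x = oct_tr A x *s oct_one A - x"

text \<open>Unital composition algebra of dimension 8; the norm is a non-degenerate quadratic form.\<close>

definition octonion_algebra :: "('k :: field) oct \<Rightarrow> bool" where
  "octonion_algebra A \<longleftrightarrow>
     (\<forall>x. Vector_Spaces.linear (*s) (*s) (\<lambda>y. oct_mult A x y)) \<and>
     (\<forall>y. Vector_Spaces.linear (*s) (*s) (\<lambda>x. oct_mult A x y)) \<and>
     (\<forall>x. oct_mult A (oct_one A) x = x \<and> oct_mult A x (oct_one A) = x) \<and>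
     (\<forall>c x. oct_norm A (c *s x) = c ^ 2 * oct_norm A x) \<and>
     (\<forall>x. Vector_Spaces.linear (*s) (*) (\<lambda>y. oct_polar A x y)) \<and>
     (\<forall>x. (\<forall>y. oct_polar A x y = 0) \<longrightarrow> x = 0) \<and>
     (\<forall>x y. oct_norm A (oct_mult A x y) = oct_norm A x * oct_norm A y)"

text \<open>
  Extension of scalars along a ring homomorphism \<open>h\<close>: the multiplication is extended
  bilinearly from the standard basis, and the norm is extended through
  \<open>N x = (\<Sum>i j. B e\<^sub>i e\<^sub>j / 2 * x\<^sub>i * x\<^sub>j)\<close> with \<open>B\<close> the polar form (characteristic not 2).
\<close>

definition oct_base_change :: "('k :: field \<Rightarrow> 'r :: comm_ring_1) \<Rightarrow> 'k oct \<Rightarrow> 'r oct" where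
  "oct_base_change h A =
     \<lparr> oct_mult = (\<lambda>x y. \<chi> l. \<Sum>i\<in>UNIV. \<Sum>j\<in>UNIV.
          h (oct_mult A (axis i 1) (axis j 1) $ l) * x $ i * y $ j),
       oct_one = (\<chi> l. h (oct_one A $ l)),
       oct_norm = (\<lambda>x. \<Sum>i\<in>UNIV. \<Sum>j\<in>UNIV.
          h (oct_polar A (axis i 1) (axis j 1) / 2) * x $ i * x $ j) \<rparr>"


section \<open>The exceptional Jordan algebra\<close>

text \<open>
  Coordinates of \<open>X\<close>: the index \<open>Inl i\<close> carries \<open>s\<^sub>i\<close>, the indices \<open>Inr (i, j)\<close> carry
  the eight coordinates of \<open>x\<^sub>i\<close>. In the numeral type \<open>3\<close> the three indices are
  \<open>1\<close>, \<open>2\<close> and \<open>3 = 0\<close>.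
\<close>

type_synonym J_index = "3 + 3 \<times> 8"
type_synonym 'r J = "'r ^ (3 + 3 \<times> 8)"

definition J_s :: "3 \<Rightarrow> 'r J \<Rightarrow> 'r" where
  "J_s i X = X $ Inl i"

definition J_x :: "3 \<Rightarrow> 'r J \<Rightarrow> 'r ^ 8" where
  "J_x i X = (\<chi> j. X $ Inr (i, j))"

definition J_matrix :: "('r :: comm_ring_1) oct \<Rightarrow> 'r J \<Rightarrow> 'r ^ 8 ^ 3 ^ 3" where
  "J_matrix A X = vector
     [vector [J_s 1 X *s oct_one A, J_x 3 X, oct_cnj A (J_x 2 X)],
      vector [oct_cnj A (J_x 3 X), J_s 2 X *s oct_one A, J_x 1 X],
      vector [J_x 2 X, oct_cnj A (J_x 1 X), J_s 3 X *s oct_one A]]"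

definition oct_matrix_mult ::
    "('r :: comm_ring_1) oct \<Rightarrow> 'r ^ 8 ^ 3 ^ 3 \<Rightarrow> 'r ^ 8 ^ 3 ^ 3 \<Rightarrow> 'r ^ 8 ^ 3 ^ 3" where
  "oct_matrix_mult A M N = (\<chi> i j. \<Sum>l\<in>UNIV. oct_mult A (M $ i $ l) (N $ l $ j))"

definition J_mult :: "('k :: field) oct \<Rightarrow> 'k J \<Rightarrow> 'k J \<Rightarrow> 'k J" where
  "J_mult A X Y = (THE Z. J_matrix A Z =
     (\<chi> i j. (1 / 2) *s (oct_matrix_mult A (J_matrix A X) (J_matrix A Y)
                        + oct_matrix_mult A (J_matrix A Y) (J_matrix A X)) $ i $ j))"

definition J_Tr :: "('r :: comm_ring_1) J \<Rightarrow> 'r" where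
  "J_Tr X = J_s 1 X + J_s 2 X + J_s 3 X"

definition J_inner :: "('k :: field) oct \<Rightarrow> 'k J \<Rightarrow> 'k J \<Rightarrow> 'k" where
  "J_inner A X Y = J_Tr (J_mult A X Y)"

text \<open>
  In an octonion algebra \<open>tr ((x y) z) = tr (x (y z))\<close>, so the bracketing in the trace term
  is immaterial.
\<close>

definition J_det :: "('r :: comm_ring_1) oct \<Rightarrow> 'r J \<Rightarrow> 'r" where
  "J_det A X = J_s 1 X * J_s 2 X * J_s 3 X
     + oct_tr A (oct_mult A (oct_mult A (J_x 1 X) (J_x 2 X)) (J_x 3 X))
     - (\<Sum>i\<in>UNIV. J_s i X * oct_norm A (J_x i X))"

definition J_D :: "('k :: field) oct \<Rightarrow> 'k J \<Rightarrow> 'k J \<Rightarrow> 'k J \<Rightarrow> 'k" where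
  "J_D A X Y Z = (J_det A (X + Y + Z) - J_det A (X + Y) - J_det A (Y + Z) - J_det A (Z + X)
     + J_det A X + J_det A Y + J_det A Z) / 6"

definition J_cross :: "('k :: field) oct \<Rightarrow> 'k J \<Rightarrow> 'k J \<Rightarrow> 'k J" where
  "J_cross A X Y = (THE W. \<forall>Z. J_inner A W Z = 3 * J_D A X Y Z)"

definition J_Q :: "('k :: field) oct \<Rightarrow> 'k J \<Rightarrow> 'k J \<Rightarrow> 'k J \<Rightarrow> 'k" where
  "J_Q A a X Y = - 6 * J_det A a * J_D A X Y a + 9 * J_D A X a a * J_D A Y a a"

definition J_Phi :: "('k :: field) oct \<Rightarrow> 'k J \<Rightarrow> 'k J \<Rightarrow> 'k J \<Rightarrow> 'k J" where
  "J_Phi A a X Y =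
     (4 * J_det A a ^ 3) *s J_cross A (J_cross A X a) (J_cross A Y a)
     + ((1 / 2) * (J_det A a ^ 2 * J_Q A a X Y - J_Q A a X a * J_Q A a Y a)) *s a"

definition isotope_mult :: "('k :: field) oct \<Rightarrow> 'k J \<Rightarrow> 'k J \<Rightarrow> 'k J \<Rightarrow> 'k J" where
  "isotope_mult A a X Y = inverse (J_det A a ^ 4) *s J_Phi A a X Y"


section \<open>Polynomials\<close>

type_synonym ('v, 'k) mpoly = "('v \<Rightarrow>\<^sub>0 nat) \<Rightarrow>\<^sub>0 'k"

definition mpoly_const :: "'k :: zero \<Rightarrow> ('v, 'k) mpoly" where
  "mpoly_const c = Poly_Mapping.single 0 c"

definition mpoly_eval ::
    "('k :: comm_ring_1 \<Rightarrow> 'r :: comm_ring_1) \<Rightarrow> ('v \<Rightarrow> 'r) \<Rightarrow> ('v, 'k) mpoly \<Rightarrow> 'r" where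
  "mpoly_eval h v p = (\<Sum>m\<in>Poly_Mapping.keys p. h (Poly_Mapping.lookup p m) *
     (\<Prod>x\<in>Poly_Mapping.keys m. v x ^ Poly_Mapping.lookup m x))"

definition mpoly_homogeneous :: "nat \<Rightarrow> ('v, 'k :: zero) mpoly \<Rightarrow> bool" where
  "mpoly_homogeneous d p \<longleftrightarrow> (\<forall>m\<in>Poly_Mapping.keys p.
     (\<Sum>x\<in>Poly_Mapping.keys m. Poly_Mapping.lookup m x) = d)"

text \<open>
  A family \<open>T i j l\<close> of polynomials in the coordinates of \<open>a\<close> gives the trilinear forms
  \<open>T\<^sub>a\<close> with \<open>T\<^sub>a e\<^sub>i e\<^sub>j e\<^sub>l\<close> the value of \<open>T i j l\<close> at \<open>a\<close>, over every extension of scalars \<open>h\<close>.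
\<close>

definition J_trilinear :: "('k :: field \<Rightarrow> 'r :: comm_ring_1) \<Rightarrow>
    (J_index \<Rightarrow> J_index \<Rightarrow> J_index \<Rightarrow> (J_index, 'k) mpoly) \<Rightarrow>
    'r J \<Rightarrow> 'r J \<Rightarrow> 'r J \<Rightarrow> 'r J \<Rightarrow> 'r" where
  "J_trilinear h T a X Y Z = (\<Sum>i\<in>UNIV. \<Sum>j\<in>UNIV. \<Sum>l\<in>UNIV.
     mpoly_eval h (\<lambda>v. a $ v) (T i j l) * X $ i * Y $ j * Z $ l)"


section \<open>The algebraic group \<open>GE\<^sub>6\<close>\<close>

text \<open>
  The group is treated through its functor of points. Let \<open>P\<close> be the polynomial ring over
  \<open>k\<close> in countably many variables. Every finitely generated commutative \<open>k\<close>-algebra is isomorphic to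
  \<open>P / I\<close> for some ideal \<open>I\<close>, and such algebras determine the group and its characters, since
  all data below are polynomial. A point with values in \<open>P / I\<close> is represented by lifted
  coordinates in \<open>P\<close>, and equations are required modulo \<open>I\<close>. (The \<open>k\<close>-points occur
  with \<open>I\<close> generated by the variables, and a point over an extension field of \<open>k\<close> is already
  defined over a finitely generated subalgebra.)
\<close>

type_synonym 'k scalars = "(nat, 'k) mpoly"
type_synonym 'r J_endo = "'r ^ (3 + 3 \<times> 8) ^ (3 + 3 \<times> 8)"

definition is_ideal :: "('r :: comm_ring_1) set \<Rightarrow> bool" where
  "is_ideal I \<longleftrightarrow> 0 \<in> I \<and> (\<forall>x\<in>I. \<forall>y\<in>I. x + y \<in> I) \<and> (\<forall>r. \<forall>x\<in>I. r * x \<in> I)"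

definition cong_ideal :: "('r :: comm_ring_1) set \<Rightarrow> 'r \<Rightarrow> 'r \<Rightarrow> bool" where
  "cong_ideal I x y \<longleftrightarrow> x - y \<in> I"

definition cong_matrix :: "('r :: comm_ring_1) set \<Rightarrow> 'r ^ 'n ^ 'm \<Rightarrow> 'r ^ 'n ^ 'm \<Rightarrow> bool" where
  "cong_matrix I L M \<longleftrightarrow> (\<forall>i j. cong_ideal I (L $ i $ j) (M $ i $ j))"

text \<open>
  \<open>GE6_points A I\<close> consists of the pairs \<open>(L, L')\<close> of a matrix \<open>L\<close> representing an element of
  \<open>GE\<^sub>6 (P / I)\<close> and a matrix \<open>L'\<close> representing its inverse.
\<close>

definition GE6_points :: "('k :: field) oct \<Rightarrow> 'k scalars set \<Rightarrow>
    ('k scalars J_endo \<times> 'k scalars J_endo) set" where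
  "GE6_points A I = {(L, L').
     cong_matrix I (L ** L') (mat 1) \<and> cong_matrix I (L' ** L) (mat 1) \<and>
     (\<exists>c c'. cong_ideal I (c * c') 1 \<and>
        (\<forall>X. cong_ideal I (J_det (oct_base_change mpoly_const A) (L *v X))
                         (c * J_det (oct_base_change mpoly_const A) X)))}"

text \<open>
  A regular function on \<open>GE\<^sub>6\<close> is the restriction of a regular function on \<open>GL\<close>, i.e. a polynomial
  in the entries of \<open>L\<close> (variables \<open>Inl (i, j)\<close>) and of its inverse (variables \<open>Inr (i, j)\<close>).
\<close>

definition GE6_eval :: "(J_index \<times> J_index + J_index \<times> J_index, 'k :: field) mpoly \<Rightarrow>
    'k scalars J_endo \<Rightarrow> 'k scalars J_endo \<Rightarrow> 'k scalars" where
  "GE6_eval \<psi> L L' = mpoly_eval mpoly_const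
     (case_sum (\<lambda>(i, j). L $ i $ j) (\<lambda>(i, j). L' $ i $ j)) \<psi>"

text \<open>A character: a homomorphism of algebraic groups to the multiplicative group.\<close>

definition GE6_character ::
    "('k :: field) oct \<Rightarrow> (J_index \<times> J_index + J_index \<times> J_index, 'k) mpoly \<Rightarrow> bool" where
  "GE6_character A \<psi> \<longleftrightarrow> (\<forall>I. is_ideal I \<longrightarrow>
     cong_ideal I (GE6_eval \<psi> (mat 1) (mat 1)) 1 \<and>
     (\<forall>(L, L')\<in>GE6_points A I. \<forall>(M, M')\<in>GE6_points A I.
        cong_ideal I (GE6_eval \<psi> (L ** M) (M' ** L')) (GE6_eval \<psi> L L' * GE6_eval \<psi> M M')))"

definition GE6_equivariant :: "('k :: field) oct \<Rightarrow>
    (J_index \<Rightarrow> J_index \<Rightarrow> J_index \<Rightarrow> (J_index, 'k) mpoly) \<Rightarrow> bool" where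
  "GE6_equivariant A T \<longleftrightarrow> (\<exists>\<psi>. GE6_character A \<psi> \<and>
     (\<forall>I. is_ideal I \<longrightarrow> (\<forall>(L, L')\<in>GE6_points A I. \<forall>a X Y Z.
        cong_ideal I
          (J_trilinear mpoly_const T (L *v a) (L *v X) (L *v Y) (L *v Z))
          (GE6_eval \<psi> L L' * J_trilinear mpoly_const T a X Y Z))))"

end

theory Submission
  imports Defs
begin

text \<open>
  Write \<open>N = det a\<close>. Two observations carry the proof.

  First, \<open>Q\<^sub>a(X,a) = 3 N D(X,a,a)\<close>, so the second summand in the definition of \<open>\<Phi>\<^sub>a\<close> collapses and
  \<open>\<Phi>\<^sub>a(X,Y) = N\<^sup>3 \<Psi>\<^sub>a(X,Y)\<close> with \<open>\<Psi>\<^sub>a(X,Y) = 4 (X \<times> a) \<times> (Y \<times> a) - 3 D(X,Y,a) a\<close> of degree two in \<open>a\<close>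
  (\<open>isotope_mult_eq\<close>). The form that the theorem asks for is therefore
  \<open>T\<^sub>a(X,Y,Z) = Q\<^sub>a(\<Psi>\<^sub>a(X,Y), Z)\<close>, of degree \<open>4 + 2 = 6\<close>, and the product is determined by it because
  \<open>Q\<^sub>a\<close> is non-degenerate (\<open>Q_nondegenerate\<close>).

  Second, the cross products can be eliminated from this expression. Differentiating the adjoint
  identity \<open>(a \<times> a) \<times> (a \<times> a) = N a\<close> twice yields a formula for \<open>D(X \<times> a, Y \<times> a, Z \<times> a)\<close> in terms
  of \<open>D\<close> (\<open>cross_cross_cross\<close>), and hence (\<open>Q_isotope_product\<close>)

  \<open>T\<^sub>a(X,Y,Z) = 27 D(X,a,a) D(Y,a,a) D(Z,a,a)
    - 9 N (D(X,Y,a) D(Z,a,a) + D(Y,Z,a) D(X,a,a) + D(X,Z,a) D(Y,a,a)) + 3 N\<^sup>2 D(X,Y,Z)\<close>.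

  This is a polynomial in values of \<open>D\<close> alone, homogeneous of degree three in them, so equivariance
  with the character \<open>c(L)\<^sup>3\<close> is formal, over any ring of scalars, from \<open>det (L X) = c(L) det X\<close>.
  The factor \<open>c(L)\<close> is the determinant of the image of the identity matrix and hence polynomial in \<open>L\<close>.

  The adjoint identity is an identity between entries of octonionic matrices (\<open>J_adjoint\<close>). The
  substantial entry is the middle Moufang identity, which, like the rest of the octonion calculus,
  follows from \<open>N(x y) = N(x) N(y)\<close> by linearization and non-degeneracy.
\<close>

section \<open>Polynomial evaluation and homogeneity\<close>

locale ring_morphism =
  fixes h :: "'a :: comm_ring_1 \<Rightarrow> 'b :: comm_ring_1"
  assumes add: "h (x + y) = h x + h y"
    and mult: "h (x * y) = h x * h y"
    and one: "h 1 = 1"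
begin

lemma zero: "h 0 = 0"
  using add[of 0 0] by simp

lemma minus: "h (x - y) = h x - h y"
  using add[of "x - y" y] by (simp add: algebra_simps)

lemma sum: "h (sum f S) = (\<Sum>i\<in>S. h (f i))"
  by (induction S rule: infinite_finite_induct) (simp_all add: zero add)

lemma power: "h (x ^ n) = h x ^ n"
  by (induction n) (simp_all add: one mult)

lemma of_nat: "h (of_nat n) = of_nat n"
  by (induction n) (simp_all add: zero one add)

lemma numeral: "h (numeral n) = numeral n"
  using of_nat[of "numeral n"] by simp

lemmas hom_simps = add mult one zero minus sum power numeral

end

lemma ring_morphism_id: "ring_morphism id"
  by unfold_locales auto

lemma ring_morphism_mpoly_const: "ring_morphism mpoly_const"
  by unfold_locales (auto simp: mpoly_const_def single_add mult_single)

definition mpoly_var :: "'v \<Rightarrow> ('v, 'k :: comm_ring_1) mpoly" where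
  "mpoly_var x = Poly_Mapping.single (Poly_Mapping.single x 1) 1"

definition monomial_eval :: "('v \<Rightarrow> 'r :: comm_ring_1) \<Rightarrow> ('v \<Rightarrow>\<^sub>0 nat) \<Rightarrow> 'r" where
  "monomial_eval v m = (\<Prod>x\<in>Poly_Mapping.keys m. v x ^ Poly_Mapping.lookup m x)"

lemma monomial_eval_superset:
  assumes "finite S" "Poly_Mapping.keys m \<subseteq> S"
  shows "monomial_eval v m = (\<Prod>x\<in>S. v x ^ Poly_Mapping.lookup m x)"
  unfolding monomial_eval_def using assms
  by (intro prod.mono_neutral_left) (auto simp: in_keys_iff)

lemma monomial_eval_add: "monomial_eval v (m + n) = monomial_eval v m * monomial_eval v n"
proof -
  let ?S = "Poly_Mapping.keys m \<union> Poly_Mapping.keys n"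
  have "monomial_eval v (m + n) = (\<Prod>x\<in>?S. v x ^ Poly_Mapping.lookup (m + n) x)"
    using keys_add[of m n] by (intro monomial_eval_superset) auto
  moreover have "monomial_eval v m = (\<Prod>x\<in>?S. v x ^ Poly_Mapping.lookup m x)"
    "monomial_eval v n = (\<Prod>x\<in>?S. v x ^ Poly_Mapping.lookup n x)"
    by (intro monomial_eval_superset; simp)+
  ultimately show ?thesis
    by (simp add: lookup_add power_add prod.distrib)
qed

lemma mpoly_sum_single:
  "p = (\<Sum>m\<in>Poly_Mapping.keys p. Poly_Mapping.single m (Poly_Mapping.lookup p m))"
  by (rule poly_mapping_eqI)
    (auto simp: lookup_sum lookup_single when_def in_keys_iff sum.delta')

context ring_morphism
begin

text \<open>
  Polynomial evaluation sums over the support of the polynomial. Two polynomials have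
  different supports, so their evaluations can be compared only after both sums are extended
  to a common finite set of exponents.
\<close>

lemma mpoly_eval_superset:
  assumes "finite S" "Poly_Mapping.keys p \<subseteq> S"
  shows "mpoly_eval h v p = (\<Sum>m\<in>S. h (Poly_Mapping.lookup p m) * monomial_eval v m)"
  unfolding mpoly_eval_def monomial_eval_def using assms
  by (intro sum.mono_neutral_left) (auto simp: in_keys_iff zero)

lemma mpoly_eval_add: "mpoly_eval h v (p + q) = mpoly_eval h v p + mpoly_eval h v q"
proof -
  let ?S = "Poly_Mapping.keys p \<union> Poly_Mapping.keys q"
  have "mpoly_eval h v (p + q)
      = (\<Sum>m\<in>?S. h (Poly_Mapping.lookup (p + q) m) * monomial_eval v m)"
    using keys_add[of p q] by (intro mpoly_eval_superset) auto
  moreover have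
    "mpoly_eval h v p = (\<Sum>m\<in>?S. h (Poly_Mapping.lookup p m) * monomial_eval v m)"
    "mpoly_eval h v q = (\<Sum>m\<in>?S. h (Poly_Mapping.lookup q m) * monomial_eval v m)"
    by (intro mpoly_eval_superset; simp)+
  ultimately show ?thesis
    by (simp add: lookup_add add algebra_simps sum.distrib)
qed

lemma mpoly_eval_sum: "mpoly_eval h v (sum f S) = (\<Sum>i\<in>S. mpoly_eval h v (f i))"
  by (induction S rule: infinite_finite_induct)
    (simp_all add: mpoly_eval_add mpoly_eval_def[of h v 0])

lemma mpoly_eval_single: "mpoly_eval h v (Poly_Mapping.single m c) = h c * monomial_eval v m"
  by (subst mpoly_eval_superset[of "{m}"]) (auto simp: lookup_single)

lemma mpoly_eval_mult: "mpoly_eval h v (p * q) = mpoly_eval h v p * mpoly_eval h v q"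
proof -
  let ?s = "\<lambda>p m. Poly_Mapping.single m (Poly_Mapping.lookup p m)"
  have "mpoly_eval h v (p * q) = mpoly_eval h v
      ((\<Sum>m\<in>Poly_Mapping.keys p. ?s p m) * (\<Sum>n\<in>Poly_Mapping.keys q. ?s q n))"
    using mpoly_sum_single[of p] mpoly_sum_single[of q] by simp
  also have "\<dots> = (\<Sum>m\<in>Poly_Mapping.keys p. \<Sum>n\<in>Poly_Mapping.keys q.
      mpoly_eval h v (?s p m) * mpoly_eval h v (?s q n))"
    by (simp add: sum_product mpoly_eval_sum mult_single mpoly_eval_single monomial_eval_add
        mult ac_simps)
  also have "\<dots> = mpoly_eval h v (\<Sum>m\<in>Poly_Mapping.keys p. ?s p m)
      * mpoly_eval h v (\<Sum>n\<in>Poly_Mapping.keys q. ?s q n)"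
    by (simp add: sum_product mpoly_eval_sum)
  also have "\<dots> = mpoly_eval h v p * mpoly_eval h v q"
    using mpoly_sum_single[of p] mpoly_sum_single[of q] by simp
  finally show ?thesis .
qed

lemma mpoly_eval_const: "mpoly_eval h v (mpoly_const c) = h c"
  by (simp add: mpoly_const_def mpoly_eval_single monomial_eval_def)

lemma mpoly_eval_var: "mpoly_eval h v (mpoly_var x) = v x"
  by (simp add: mpoly_var_def mpoly_eval_single monomial_eval_def one)

lemma ring_morphism_mpoly_eval: "ring_morphism (mpoly_eval h v)"
  using mpoly_eval_const[of v 1]
  by unfold_locales (auto simp: mpoly_eval_add mpoly_eval_mult mpoly_const_def one)

end

abbreviation monomial_degree :: "('v \<Rightarrow>\<^sub>0 nat) \<Rightarrow> nat" where
  "monomial_degree m \<equiv> (\<Sum>x\<in>Poly_Mapping.keys m. Poly_Mapping.lookup m x)"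

lemma monomial_degree_add: "monomial_degree (m + n) = monomial_degree m + monomial_degree n"
proof -
  let ?S = "Poly_Mapping.keys m \<union> Poly_Mapping.keys n"
  have *: "monomial_degree l = (\<Sum>x\<in>?S. Poly_Mapping.lookup l x)"
    if "Poly_Mapping.keys l \<subseteq> ?S" for l
    using that by (intro sum.mono_neutral_left) (auto simp: in_keys_iff)
  show ?thesis
    using *[OF keys_add] *[of m] *[of n] by (simp add: lookup_add sum.distrib)
qed

lemma homogeneous_zero: "mpoly_homogeneous d 0"
  by (simp add: mpoly_homogeneous_def)

lemma homogeneous_const: "mpoly_homogeneous 0 (mpoly_const c)"
  by (simp add: mpoly_homogeneous_def mpoly_const_def)

lemma homogeneous_var: "mpoly_homogeneous 1 (mpoly_var x)"
  by (simp add: mpoly_homogeneous_def mpoly_var_def)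

lemma homogeneous_add:
  fixes p q :: "('v, 'k :: comm_ring_1) mpoly"
  assumes "mpoly_homogeneous d p" "mpoly_homogeneous d q"
  shows "mpoly_homogeneous d (p + q)"
  using assms keys_add[of p q] unfolding mpoly_homogeneous_def by blast

lemma homogeneous_diff:
  fixes p q :: "('v, 'k :: comm_ring_1) mpoly"
  assumes "mpoly_homogeneous d p" "mpoly_homogeneous d q"
  shows "mpoly_homogeneous d (p - q)"
  using assms keys_diff[of p q] unfolding mpoly_homogeneous_def by blast

lemma homogeneous_sum:
  fixes f :: "'i \<Rightarrow> ('v, 'k :: comm_ring_1) mpoly"
  assumes "\<And>i. i \<in> S \<Longrightarrow> mpoly_homogeneous d (f i)"
  shows "mpoly_homogeneous d (sum f S)"
  using assms
  by (induction S rule: infinite_finite_induct) (auto intro: homogeneous_zero homogeneous_add)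

lemma homogeneous_mult:
  fixes p q :: "('v, 'k :: comm_ring_1) mpoly"
  assumes "mpoly_homogeneous d p" "mpoly_homogeneous e q" "n = d + e"
  shows "mpoly_homogeneous n (p * q)"
  unfolding mpoly_homogeneous_def
proof
  fix m assume "m \<in> Poly_Mapping.keys (p * q)"
  then obtain a b where "m = a + b" "a \<in> Poly_Mapping.keys p" "b \<in> Poly_Mapping.keys q"
    using keys_mult[of p q] by blast
  then show "monomial_degree m = n"
    using assms unfolding mpoly_homogeneous_def by (simp add: monomial_degree_add)
qed

lemma homogeneous_numeral: "mpoly_homogeneous 0 (numeral n :: ('v, 'k :: comm_ring_1) mpoly)"
  using homogeneous_const[of "numeral n :: 'k"] ring_morphism.numeral[OF ring_morphism_mpoly_const]
  by metis

section \<open>The cubic form over an arbitrary ring of scalars\<close>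

text \<open>
  The properties of the product and the norm that make the determinant a cubic form. They hold
  over every extension of scalars, by the mere shape of the formulas for the base change.
\<close>

locale quadratic_algebra =
  fixes A :: "('r :: comm_ring_1) oct"
  assumes mult_add_left: "oct_mult A (x + x') y = oct_mult A x y + oct_mult A x' y"
    and mult_add_right: "oct_mult A x (y + y') = oct_mult A x y + oct_mult A x y'"
    and mult_scale_left: "oct_mult A (c *s x) y = c *s oct_mult A x y"
    and mult_scale_right: "oct_mult A x (c *s y) = c *s oct_mult A x y"
    and polar_add_left: "oct_polar A (x + x') y = oct_polar A x y + oct_polar A x' y"
    and polar_scale_left: "oct_polar A (c *s x) y = c * oct_polar A x y"
    and norm_scale: "oct_norm A (c *s x) = c ^ 2 * oct_norm A x"

lemma oct_polar_commute: "oct_polar A x y = oct_polar A y x"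
  by (simp add: oct_polar_def algebra_simps)

lemma oct_norm_add: "oct_norm A (x + y) = oct_norm A x + oct_norm A y + oct_polar A x y"
  by (simp add: oct_polar_def)

lemma J_s_add: "J_s i (X + Y) = J_s i X + J_s i Y"
  by (simp add: J_s_def)

lemma J_s_scale: "J_s i (c *s X) = c * J_s i X"
  by (simp add: J_s_def)

lemma J_x_add: "J_x i (X + Y) = J_x i X + J_x i Y"
  by (simp add: J_x_def vec_eq_iff)

lemma J_x_scale: "J_x i (c *s X) = c *s J_x i X"
  by (simp add: J_x_def vec_eq_iff)

definition oct_triple :: "('r :: comm_ring_1) oct \<Rightarrow> 'r ^ 8 \<Rightarrow> 'r ^ 8 \<Rightarrow> 'r ^ 8 \<Rightarrow> 'r" where
  "oct_triple A x y z = oct_tr A (oct_mult A (oct_mult A x y) z)"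

text \<open>
  The full polarization, that is \<open>6D\<close>. The factor 6 is left in so that it makes sense over
  every ring.
\<close>

definition J_polarization :: "('r :: comm_ring_1) oct \<Rightarrow> 'r J \<Rightarrow> 'r J \<Rightarrow> 'r J \<Rightarrow> 'r" where
  "J_polarization A X Y Z = J_det A (X + Y + Z) - J_det A (X + Y) - J_det A (Y + Z) - J_det A (Z + X)
     + J_det A X + J_det A Y + J_det A Z"

text \<open>
  On the diagonal this is the part of the determinant that is multilinear in the three
  different indices; the rest, \<open>- \<Sum>\<^sub>i s\<^sub>i N x\<^sub>i\<close>, is a sum over a single index.
\<close>

definition J_mixed :: "('r :: comm_ring_1) oct \<Rightarrow> 'r J \<Rightarrow> 'r J \<Rightarrow> 'r J \<Rightarrow> 'r" where
  "J_mixed A X Y Z = J_s 1 X * J_s 2 Y * J_s 3 Z + oct_triple A (J_x 1 X) (J_x 2 Y) (J_x 3 Z)"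

context quadratic_algebra
begin

lemma polar_add_right: "oct_polar A x (y + y') = oct_polar A x y + oct_polar A x y'"
  using polar_add_left oct_polar_commute[of A] by metis

lemma polar_scale_right: "oct_polar A x (c *s y) = c * oct_polar A x y"
  using polar_scale_left oct_polar_commute[of A] by metis

lemma polar_self: "oct_polar A x x = 2 * oct_norm A x"
proof -
  have "x + x = 2 *s x"
    by (simp add: vec_eq_iff)
  then show ?thesis
    by (simp add: oct_polar_def norm_scale)
qed

lemma triple_add:
  "oct_triple A (x + x') y z = oct_triple A x y z + oct_triple A x' y z"
  "oct_triple A x (y + y') z = oct_triple A x y z + oct_triple A x y' z"
  "oct_triple A x y (z + z') = oct_triple A x y z + oct_triple A x y z'"
  by (simp_all add: oct_triple_def oct_tr_def mult_add_left mult_add_right polar_add_left)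

lemma triple_scale:
  "oct_triple A (c *s x) y z = c * oct_triple A x y z"
  "oct_triple A x (c *s y) z = c * oct_triple A x y z"
  "oct_triple A x y (c *s z) = c * oct_triple A x y z"
  by (simp_all add: oct_triple_def oct_tr_def mult_scale_left mult_scale_right polar_scale_left)

lemma J_mixed_add:
  "J_mixed A (X + X') Y Z = J_mixed A X Y Z + J_mixed A X' Y Z"
  "J_mixed A X (Y + Y') Z = J_mixed A X Y Z + J_mixed A X Y' Z"
  "J_mixed A X Y (Z + Z') = J_mixed A X Y Z + J_mixed A X Y Z'"
  by (simp_all add: J_mixed_def J_s_add J_x_add triple_add algebra_simps)

lemma J_mixed_scale:
  "J_mixed A (c *s X) Y Z = c * J_mixed A X Y Z"
  "J_mixed A X (c *s Y) Z = c * J_mixed A X Y Z"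
  "J_mixed A X Y (c *s Z) = c * J_mixed A X Y Z"
  by (simp_all add: J_mixed_def J_s_scale J_x_scale triple_scale algebra_simps)

text \<open>
  The determinant is a product of three linear forms, a trilinear form and products of a linear
  with a quadratic form, and the full polarization of each is visibly trilinear. This formula
  is also what identifies the cross product later.
\<close>

lemma J_polarization_eq:
  "J_polarization A X Y Z =
     J_mixed A X Y Z + J_mixed A X Z Y + J_mixed A Y X Z + J_mixed A Y Z X
       + J_mixed A Z X Y + J_mixed A Z Y X
     - (\<Sum>i\<in>UNIV. J_s i X * oct_polar A (J_x i Y) (J_x i Z)
          + J_s i Y * oct_polar A (J_x i X) (J_x i Z)
          + J_s i Z * oct_polar A (J_x i X) (J_x i Y))"
proof -
  define n where "n i W = J_s i W * oct_norm A (J_x i W)" for i W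
  have det: "J_det A W = J_mixed A W W W - (\<Sum>i\<in>UNIV. n i W)" for W
    by (simp add: J_det_def J_mixed_def oct_triple_def n_def)
  have n: "n i (X + Y + Z) - n i (X + Y) - n i (Y + Z) - n i (Z + X) + n i X + n i Y + n i Z
      = J_s i X * oct_polar A (J_x i Y) (J_x i Z) + J_s i Y * oct_polar A (J_x i X) (J_x i Z)
          + J_s i Z * oct_polar A (J_x i X) (J_x i Y)" for i
    using oct_polar_commute[of A "J_x i Z" "J_x i X"]
    by (simp add: n_def J_s_add J_x_add oct_norm_add polar_add_left polar_add_right algebra_simps)
  have "J_polarization A X Y Z =
      J_mixed A X Y Z + J_mixed A X Z Y + J_mixed A Y X Z + J_mixed A Y Z X
       + J_mixed A Z X Y + J_mixed A Z Y X
      - (\<Sum>i\<in>UNIV. n i (X + Y + Z) - n i (X + Y) - n i (Y + Z) - n i (Z + X)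
          + n i X + n i Y + n i Z)"
    unfolding J_polarization_def det
    by (simp add: J_mixed_add sum_subtractf sum.distrib)
  then show ?thesis
    unfolding n .
qed

end

locale symmetric_trilinear =
  fixes F :: "('r :: comm_ring_1) ^ ('n :: finite) \<Rightarrow> 'r ^ 'n \<Rightarrow> 'r ^ 'n \<Rightarrow> 'r"
  assumes add: "F (X + X') Y Z = F X Y Z + F X' Y Z"
    and scale: "F (c *s X) Y Z = c * F X Y Z"
    and swap12: "F X Y Z = F Y X Z"
    and swap23: "F X Y Z = F X Z Y"
begin

lemma zero: "F 0 Y Z = 0"
  using scale[of 0 0] by simp

lemma sum: "F (sum f S) Y Z = (\<Sum>i\<in>S. F (f i) Y Z)"
  by (induction S rule: infinite_finite_induct) (simp_all add: zero add)

lemma expand_first: "F X Y Z = (\<Sum>i\<in>UNIV. X $ i * F (axis i 1) Y Z)"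
proof -
  have "F X Y Z = F (\<Sum>i\<in>UNIV. X $ i *s axis i 1) Y Z"
    by (simp add: basis_expansion)
  then show ?thesis
    by (simp add: sum scale)
qed

lemma expand:
  "F X Y Z = (\<Sum>i\<in>UNIV. \<Sum>j\<in>UNIV. \<Sum>l\<in>UNIV.
     F (axis i 1) (axis j 1) (axis l 1) * X $ i * Y $ j * Z $ l)"
proof -
  have 2: "F X Y Z = (\<Sum>j\<in>UNIV. Y $ j * F X (axis j 1) Z)" for X Y Z
    unfolding swap12[of X Y Z] swap12[of X "axis j 1" Z for j] by (rule expand_first)
  have 3: "F X Y Z = (\<Sum>l\<in>UNIV. Z $ l * F X Y (axis l 1))" for X Y Z
    unfolding swap23[of X Y Z] swap23[of X Y "axis l 1" for l] by (rule 2)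
  have "F X Y Z = (\<Sum>i\<in>UNIV. X $ i * F (axis i 1) Y Z)"
    by (rule expand_first)
  also have "\<dots> = (\<Sum>i\<in>UNIV. X $ i * (\<Sum>j\<in>UNIV. Y $ j * F (axis i 1) (axis j 1) Z))"
    by (intro sum.cong refl arg_cong2[where f = "(*)"] 2)
  also have "\<dots> = (\<Sum>i\<in>UNIV. X $ i * (\<Sum>j\<in>UNIV. Y $ j *
      (\<Sum>l\<in>UNIV. Z $ l * F (axis i 1) (axis j 1) (axis l 1))))"
    by (intro sum.cong refl arg_cong2[where f = "(*)"] 3)
  finally show ?thesis
    by (simp add: sum_distrib_left ac_simps)
qed

end

lemma (in quadratic_algebra) symmetric_trilinear_J_polarization:
  "symmetric_trilinear (J_polarization A)"
proof
  show "J_polarization A X Y Z = J_polarization A Y X Z" for X Y Z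
    unfolding J_polarization_def by (simp add: ac_simps)
  show "J_polarization A X Y Z = J_polarization A X Z Y" for X Y Z
    unfolding J_polarization_def by (simp add: ac_simps)
  show "J_polarization A (X + X') Y Z = J_polarization A X Y Z + J_polarization A X' Y Z"
    for X X' Y Z
    unfolding J_polarization_eq
    by (simp add: J_mixed_add J_s_add J_x_add polar_add_left algebra_simps sum.distrib)
  show "J_polarization A (c *s X) Y Z = c * J_polarization A X Y Z" for c X Y Z
    unfolding J_polarization_eq
    by (simp add: J_mixed_scale J_s_scale J_x_scale polar_scale_left algebra_simps
        sum_distrib_left)
qed

lemma (in quadratic_algebra) J_polarization_diagonal: "J_polarization A X X X = 6 * J_det A X"
  unfolding J_polarization_eq J_det_def
  by (simp add: J_mixed_def oct_triple_def polar_self sum_3 algebra_simps)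

text \<open>
  The structure constants of \<open>A\<close> over an extension \<open>h\<close> are the images of those over \<open>k\<close>. All
  constructions below therefore commute with entrywise application of a ring morphism, which
  transports identities from \<open>k\<close> to extensions and from generic to special points.
\<close>

definition map_vec :: "('r \<Rightarrow> 's) \<Rightarrow> 'r ^ 'n \<Rightarrow> 's ^ 'n" where
  "map_vec \<phi> x = (\<chi> i. \<phi> (x $ i))"

lemma map_vec_nth [simp]: "map_vec \<phi> x $ i = \<phi> (x $ i)"
  by (simp add: map_vec_def)

lemma J_s_map_vec: "J_s i (map_vec \<phi> X) = \<phi> (J_s i X)"
  by (simp add: J_s_def)

lemma J_x_map_vec: "J_x i (map_vec \<phi> X) = map_vec \<phi> (J_x i X)"
  by (simp add: J_x_def vec_eq_iff)

context ring_morphism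
begin

lemma map_vec_add: "map_vec h (x + y) = map_vec h x + map_vec h y"
  by (simp add: vec_eq_iff add)

lemma map_vec_axis: "map_vec h (axis i 1) = axis i 1"
  by (simp add: vec_eq_iff axis_def one zero)

lemma base_change_mult:
  "oct_mult (oct_base_change (h \<circ> g) A) (map_vec h x) (map_vec h y)
     = map_vec h (oct_mult (oct_base_change g A) x y)"
  by (simp add: oct_base_change_def vec_eq_iff hom_simps)

lemma base_change_norm:
  "oct_norm (oct_base_change (h \<circ> g) A) (map_vec h x) = h (oct_norm (oct_base_change g A) x)"
  by (simp add: oct_base_change_def hom_simps)

lemma base_change_one:
  "oct_one (oct_base_change (h \<circ> g) A) = map_vec h (oct_one (oct_base_change g A))"
  by (simp add: oct_base_change_def vec_eq_iff)

lemma base_change_tr: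
  "oct_tr (oct_base_change (h \<circ> g) A) (map_vec h x) = h (oct_tr (oct_base_change g A) x)"
  by (simp add: oct_tr_def oct_polar_def base_change_one base_change_norm
      map_vec_add[symmetric] minus)

lemma J_det_base_change:
  "J_det (oct_base_change (h \<circ> g) A) (map_vec h X) = h (J_det (oct_base_change g A) X)"
  by (simp add: J_det_def J_s_map_vec J_x_map_vec base_change_mult base_change_norm
      base_change_tr hom_simps)


end

lemma quadratic_algebra_base_change:
  fixes h :: "'a :: field \<Rightarrow> 'b :: comm_ring_1"
  shows "quadratic_algebra (oct_base_change h A)"
proof -
  let ?A = "oct_base_change h A"
  have polar: "oct_polar ?A x y = (\<Sum>i\<in>UNIV. \<Sum>j\<in>UNIV.
      h (oct_polar A (axis i 1) (axis j 1) / 2) * (x $ i * y $ j + y $ i * x $ j))" for x y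
    unfolding oct_polar_def[of ?A]
    by (simp add: oct_base_change_def sum_subtractf sum.distrib algebra_simps)
  show ?thesis
  proof
    fix x x' y y' :: "'b ^ 8" and c
    show "oct_mult ?A (x + x') y = oct_mult ?A x y + oct_mult ?A x' y"
      "oct_mult ?A x (y + y') = oct_mult ?A x y + oct_mult ?A x y'"
      by (simp_all add: oct_base_change_def vec_eq_iff distrib_left distrib_right sum.distrib)
    show "oct_mult ?A (c *s x) y = c *s oct_mult ?A x y"
      "oct_mult ?A x (c *s y) = c *s oct_mult ?A x y"
      by (simp_all add: oct_base_change_def vec_eq_iff sum_distrib_left ac_simps)
    show "oct_polar ?A (x + x') y = oct_polar ?A x y + oct_polar ?A x' y"
      unfolding polar by (simp add: distrib_left distrib_right sum.distrib)
    show "oct_polar ?A (c *s x) y = c * oct_polar ?A x y"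
      unfolding polar by (simp add: distrib_left sum_distrib_left ac_simps)
    show "oct_norm ?A (c *s x) = c ^ 2 * oct_norm ?A x"
      by (simp add: oct_base_change_def sum_distrib_left power2_eq_square ac_simps)
  qed
qed

lemma field_char_not_2_3:
  assumes "CHAR('k :: field) \<noteq> 2" "CHAR('k) \<noteq> 3"
  shows "(2 :: 'k) \<noteq> 0" "(3 :: 'k) \<noteq> 0"
proof -
  have *: "of_nat p \<noteq> (0 :: 'k)" if "prime p" "CHAR('k) \<noteq> p" for p
    using that CHAR_not_1[where 'a = 'k]
    by (auto simp: of_nat_eq_0_iff_char_dvd prime_nat_iff)
  show "(2 :: 'k) \<noteq> 0" "(3 :: 'k) \<noteq> 0"
    using *[of 2] *[of 3] assms by auto
qed

lemma field_6_nonzero: "(2 :: 'k :: field) \<noteq> 0 \<Longrightarrow> (3 :: 'k) \<noteq> 0 \<Longrightarrow> (6 :: 'k) \<noteq> 0"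
  using mult_eq_0_iff[of "2 :: 'k" 3] by simp

locale octonions =
  fixes A :: "('k :: field) oct"
  assumes octonion: "octonion_algebra A"
    and two: "(2 :: 'k) \<noteq> 0"
    and three: "(3 :: 'k) \<noteq> 0"

sublocale octonions \<subseteq> quadratic_algebra A
proof
  have "module_hom (*s) (*s) (\<lambda>y. oct_mult A x y)"
    "module_hom (*s) (*s) (\<lambda>x. oct_mult A x y)"
    "module_hom (*s) (*) (\<lambda>y. oct_polar A x y)" for x y
    using octonion by (auto simp: octonion_algebra_def linear_iff_module_hom)
  note * = this[unfolded module_hom_iff]
  show "oct_mult A (x + x') y = oct_mult A x y + oct_mult A x' y"
    "oct_mult A x (y + y') = oct_mult A x y + oct_mult A x y'"
    "oct_mult A (c *s x) y = c *s oct_mult A x y"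
    "oct_mult A x (c *s y) = c *s oct_mult A x y" for x x' y y' c
    using * by auto
  show "oct_polar A (x + x') y = oct_polar A x y + oct_polar A x' y"
    "oct_polar A (c *s x) y = c * oct_polar A x y" for x x' y c
    using *(3) unfolding oct_polar_commute[of A _ y] by auto
  show "oct_norm A (c *s x) = c\<^sup>2 * oct_norm A x" for c x
    using octonion by (simp add: octonion_algebra_def)
qed

context octonions
begin

lemma mult_sum_left: "oct_mult A (sum f S) y = (\<Sum>i\<in>S. oct_mult A (f i) y)"
  using mult_scale_left[of 0 0]
  by (induction S rule: infinite_finite_induct) (simp_all add: mult_add_left)

lemma mult_sum_right: "oct_mult A x (sum f S) = (\<Sum>i\<in>S. oct_mult A x (f i))"
  using mult_scale_right[of _ 0 0]
  by (induction S rule: infinite_finite_induct) (simp_all add: mult_add_right)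

lemma polar_sum_left: "oct_polar A (sum f S) y = (\<Sum>i\<in>S. oct_polar A (f i) y)"
  using polar_scale_left[of 0 0]
  by (induction S rule: infinite_finite_induct) (simp_all add: polar_add_left)

lemma polar_sum_right: "oct_polar A x (sum f S) = (\<Sum>i\<in>S. oct_polar A x (f i))"
  unfolding oct_polar_commute[of A x] by (rule polar_sum_left)

text \<open>
  The base change is built from structure constants and half the polar form, so along the identity it
  gives back \<open>A\<close> because the product is bilinear and \<open>N x = B x x / 2\<close>.
\<close>

lemma base_change_id: "oct_base_change id A = A"
proof -
  have mult: "oct_mult A x y = (\<chi> l. \<Sum>i\<in>UNIV. \<Sum>j\<in>UNIV.
      oct_mult A (axis i 1) (axis j 1) $ l * x $ i * y $ j)" for x y
  proof -
    have "oct_mult A x y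
        = oct_mult A (\<Sum>i\<in>UNIV. x $ i *s axis i 1) (\<Sum>j\<in>UNIV. y $ j *s axis j 1)"
      by (simp add: basis_expansion)
    also have "\<dots> = (\<Sum>i\<in>UNIV. x $ i *s oct_mult A (axis i 1) (\<Sum>j\<in>UNIV. y $ j *s axis j 1))"
      by (simp only: mult_sum_left mult_scale_left)
    finally show ?thesis
      by (simp add: mult_sum_left mult_sum_right mult_scale_left mult_scale_right vec_eq_iff
          sum_distrib_left ac_simps)
  qed
  have norm: "oct_norm A x = (\<Sum>i\<in>UNIV. \<Sum>j\<in>UNIV.
      oct_polar A (axis i 1) (axis j 1) / 2 * x $ i * x $ j)" for x
  proof -
    have "2 * oct_norm A x = oct_polar A x x"
      by (simp add: polar_self)
    also have "\<dots> = oct_polar A (\<Sum>i\<in>UNIV. x $ i *s axis i 1) (\<Sum>j\<in>UNIV. x $ j *s axis j 1)"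
      by (simp add: basis_expansion)
    also have "\<dots> = (\<Sum>i\<in>UNIV. x $ i * oct_polar A (axis i 1) (\<Sum>j\<in>UNIV. x $ j *s axis j 1))"
      by (simp only: polar_sum_left polar_scale_left)
    also have "\<dots> = (\<Sum>i\<in>UNIV. \<Sum>j\<in>UNIV. oct_polar A (axis i 1) (axis j 1) * x $ i * x $ j)"
      by (simp add: polar_sum_left polar_sum_right polar_scale_left polar_scale_right
          sum_distrib_left ac_simps)
    also have "\<dots> = 2 * (\<Sum>i\<in>UNIV. \<Sum>j\<in>UNIV.
        oct_polar A (axis i 1) (axis j 1) / 2 * x $ i * x $ j)"
      using two by (simp add: sum_distrib_left)
    finally show ?thesis
      using two by simp
  qed
  have "oct_mult (oct_base_change id A) x y = oct_mult A x y"
    "oct_norm (oct_base_change id A) x = oct_norm A x" for x y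
    unfolding mult[of x y] norm[of x] by (simp_all add: oct_base_change_def)
  moreover have "oct_one (oct_base_change id A) = oct_one A"
    by (simp add: oct_base_change_def)
  ultimately show ?thesis
    by (intro oct.equality ext) auto
qed

end

text \<open>
  The form \<open>D\<close> after extension of scalars along \<open>h\<close>. The constant \<open>1 / 6\<close> is taken in the
  field and then mapped, as the extension need not be a field.
\<close>

definition J_D_over :: "('k :: field \<Rightarrow> 'r :: comm_ring_1) \<Rightarrow> 'k oct \<Rightarrow>
    'r J \<Rightarrow> 'r J \<Rightarrow> 'r J \<Rightarrow> 'r" where
  "J_D_over h A X Y Z = h (1 / 6) * J_polarization (oct_base_change h A) X Y Z"

lemma (in ring_morphism) J_D_over_natural:
  "J_D_over (h \<circ> g) A (map_vec h X) (map_vec h Y) (map_vec h Z) = h (J_D_over g A X Y Z)"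
  by (simp add: J_D_over_def J_polarization_def J_det_base_change map_vec_add[symmetric]
      hom_simps)

lemma symmetric_trilinear_J_D_over: "symmetric_trilinear (J_D_over h A)"
proof -
  interpret quadratic_algebra "oct_base_change h A"
    by (rule quadratic_algebra_base_change)
  interpret P: symmetric_trilinear "J_polarization (oct_base_change h A)"
    by (rule symmetric_trilinear_J_polarization)
  show ?thesis
    unfolding J_D_over_def
    by unfold_locales
      (simp_all add: P.add P.scale algebra_simps, simp_all add: P.swap12 P.swap23)
qed

context octonions
begin

lemmas six = field_6_nonzero[OF two three]

lemma J_D_over_id: "J_D_over id A = J_D A"
  by (simp add: fun_eq_iff J_D_over_def J_polarization_def J_D_def base_change_id)

lemma symmetric_trilinear_J_D: "symmetric_trilinear (J_D A)"
  using symmetric_trilinear_J_D_over[of id A] by (simp add: J_D_over_id)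

lemma J_D_over_diagonal:
  assumes "ring_morphism h"
  shows "J_D_over h A X X X = J_det (oct_base_change h A) X"
proof -
  interpret ring_morphism h by fact
  have "h (1 / 6) * 6 = h (1 / 6 * 6)"
    by (simp only: mult numeral)
  then show ?thesis
    using six by (simp add: J_D_over_def one mult.assoc[symmetric]
        quadratic_algebra.J_polarization_diagonal[OF quadratic_algebra_base_change])
qed

lemma J_D_diagonal: "J_D A X X X = J_det A X"
  using J_D_over_diagonal[OF ring_morphism_id] by (simp add: J_D_over_id base_change_id)

end

section \<open>The trilinear forms \<open>T\<^sub>a\<close>\<close>

text \<open>
  For \<open>F = D\<close> these are the forms \<open>T\<^sub>a\<close>. For \<open>X = Y = Z\<close> the form reads
  \<open>27 D(X,a,a)\<^sup>3 - 27 N D(X,X,a) D(X,a,a) + 3 N\<^sup>2 N(X)\<close> with \<open>N = D(a,a,a)\<close>. If \<open>a\<close> is the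
  identity matrix, this is \<open>Tr X\<^sup>3 - 3 S(X) Tr X + 3 N(X)\<close> with \<open>S\<close> the quadratic trace, the sum of
  the cubes of the three eigenvalues by Newton's identity.
\<close>

definition trace_form :: "('v \<Rightarrow> 'v \<Rightarrow> 'v \<Rightarrow> 'r :: comm_ring_1) \<Rightarrow> 'v \<Rightarrow> 'v \<Rightarrow> 'v \<Rightarrow> 'v \<Rightarrow> 'r" where
  "trace_form F a X Y Z = 27 * F X a a * F Y a a * F Z a a
     - 9 * F a a a * (F X Y a * F Z a a + F Y Z a * F X a a + F X Z a * F Y a a)
     + 3 * F a a a ^ 2 * F X Y Z"

lemma (in symmetric_trilinear) symmetric_trilinear_trace_form:
  "symmetric_trilinear (trace_form F a)"
proof
  show "trace_form F a (X + X') Y Z = trace_form F a X Y Z + trace_form F a X' Y Z" for X X' Y Z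
    by (simp add: trace_form_def add algebra_simps)
  show "trace_form F a (c *s X) Y Z = c * trace_form F a X Y Z" for c X Y Z
    by (simp add: trace_form_def scale algebra_simps)
  show "trace_form F a X Y Z = trace_form F a Y X Z" for X Y Z
    unfolding trace_form_def swap12[of X Y] by (simp add: algebra_simps)
  show "trace_form F a X Y Z = trace_form F a X Z Y" for X Y Z
    unfolding trace_form_def swap12[of Y Z] swap23[of X Y Z] by (simp add: algebra_simps)
qed

text \<open>
  The coefficient polynomials are the values of the form at the generic point, whose
  coordinates are the variables themselves.
\<close>

definition trace_form_poly :: "('k :: field) oct \<Rightarrow>
    J_index \<Rightarrow> J_index \<Rightarrow> J_index \<Rightarrow> (J_index, 'k) mpoly" where
  "trace_form_poly A i j l =
     trace_form (J_D_over mpoly_const A) (\<chi> v. mpoly_var v) (axis i 1) (axis j 1) (axis l 1)"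

text \<open>
  Evaluation at \<open>a\<close> is a ring morphism that sends the generic point to \<open>a\<close> and fixes the basis
  vectors; the claim is naturality along this morphism, followed by expansion in the basis.
\<close>

lemma J_trilinear_trace_form_poly:
  assumes "ring_morphism h"
  shows "J_trilinear h (trace_form_poly A) a X Y Z = trace_form (J_D_over h A) a X Y Z"
proof -
  interpret h: ring_morphism h by fact
  define \<epsilon> where "\<epsilon> = mpoly_eval h (\<lambda>v. a $ v)"
  interpret \<epsilon>: ring_morphism \<epsilon>
    unfolding \<epsilon>_def by (rule h.ring_morphism_mpoly_eval)
  have h: "\<epsilon> \<circ> mpoly_const = h"
    by (simp add: fun_eq_iff \<epsilon>_def h.mpoly_eval_const)
  have a: "map_vec \<epsilon> (\<chi> v. mpoly_var v) = a"
    by (simp add: vec_eq_iff \<epsilon>_def h.mpoly_eval_var)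
  have natural: "\<epsilon> (J_D_over mpoly_const A X Y Z)
      = J_D_over h A (map_vec \<epsilon> X) (map_vec \<epsilon> Y) (map_vec \<epsilon> Z)" for X Y Z
    by (simp add: \<epsilon>.J_D_over_natural[symmetric] h)
  have "\<epsilon> (trace_form_poly A i j l)
      = trace_form (J_D_over h A) a (axis i 1) (axis j 1) (axis l 1)" for i j l
    by (simp add: trace_form_poly_def trace_form_def \<epsilon>.hom_simps natural a \<epsilon>.map_vec_axis)
  then have "J_trilinear h (trace_form_poly A) a X Y Z = (\<Sum>i\<in>UNIV. \<Sum>j\<in>UNIV. \<Sum>l\<in>UNIV.
      trace_form (J_D_over h A) a (axis i 1) (axis j 1) (axis l 1) * X $ i * Y $ j * Z $ l)"
    unfolding J_trilinear_def \<epsilon>_def by simp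
  also have "\<dots> = trace_form (J_D_over h A) a X Y Z"
    by (rule symmetric_trilinear.expand[symmetric]
        symmetric_trilinear.symmetric_trilinear_trace_form symmetric_trilinear_J_D_over)+
  finally show ?thesis .
qed

lemma (in octonions) homogeneous_J_D_over:
  assumes "\<And>v. mpoly_homogeneous p (X $ v)" "\<And>v. mpoly_homogeneous q (Y $ v)"
    "\<And>v. mpoly_homogeneous r (Z $ v)" "n = p + q + r"
  shows "mpoly_homogeneous n (J_D_over mpoly_const A X Y Z)"
proof -
  interpret ring_morphism "mpoly_const :: 'k \<Rightarrow> (_, 'k) mpoly"
    by (rule ring_morphism_mpoly_const)
  have coeff: "J_D_over mpoly_const A (axis i 1) (axis j 1) (axis l 1)
      = mpoly_const (J_D A (axis i 1) (axis j 1) (axis l 1))" for i j l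
    using J_D_over_natural[of id A "axis i 1" "axis j 1" "axis l 1"]
    by (simp add: J_D_over_id map_vec_axis)
  show ?thesis
    unfolding symmetric_trilinear.expand[OF symmetric_trilinear_J_D_over, of _ _ X Y Z] coeff
    using assms
    by (intro homogeneous_sum homogeneous_mult[where d = "p + q" and e = r]
        homogeneous_mult[where d = p and e = q] homogeneous_mult[where d = 0 and e = p]
        homogeneous_const) auto
qed

lemma (in octonions) homogeneous_trace_form_poly: "mpoly_homogeneous 6 (trace_form_poly A i j l)"
proof -
  have e: "mpoly_homogeneous 0 ((axis i 1 :: (J_index, 'k) mpoly J) $ v)" for i v
    using homogeneous_const[of "1 :: 'k"] homogeneous_zero
    by (auto simp: axis_def mpoly_const_def)
  have x: "mpoly_homogeneous 1 (((\<chi> v. mpoly_var v) :: (J_index, 'k) mpoly J) $ v)" for v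
    by (simp add: homogeneous_var[unfolded One_nat_def])
  note D = homogeneous_J_D_over[OF e x x refl] homogeneous_J_D_over[OF e e x refl]
    homogeneous_J_D_over[OF x x x refl] homogeneous_J_D_over[OF e e e refl]
  show ?thesis
    unfolding trace_form_poly_def trace_form_def power2_eq_square
    by (rule homogeneous_add homogeneous_diff homogeneous_mult homogeneous_numeral D | simp)+
qed

section \<open>Equivariance\<close>

lemma cong_ideal_refl: "is_ideal I \<Longrightarrow> cong_ideal I x x"
  by (simp add: cong_ideal_def is_ideal_def)

lemma ideal_uminus: "is_ideal I \<Longrightarrow> x \<in> I \<Longrightarrow> - x \<in> I"
  unfolding is_ideal_def using mult_minus1[of x] by metis

lemma cong_ideal_sym: "is_ideal I \<Longrightarrow> cong_ideal I x y \<Longrightarrow> cong_ideal I y x"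
  using ideal_uminus[of I "x - y"] by (simp add: cong_ideal_def)

lemma cong_ideal_add:
  "is_ideal I \<Longrightarrow> cong_ideal I x y \<Longrightarrow> cong_ideal I x' y' \<Longrightarrow> cong_ideal I (x + x') (y + y')"
  unfolding cong_ideal_def is_ideal_def add_diff_add by blast

lemma cong_ideal_trans:
  "is_ideal I \<Longrightarrow> cong_ideal I x y \<Longrightarrow> cong_ideal I y z \<Longrightarrow> cong_ideal I x z"
  using cong_ideal_add[of I x y y z] by (simp add: cong_ideal_def)

lemma cong_ideal_diff:
  assumes "is_ideal I" "cong_ideal I x y" "cong_ideal I x' y'"
  shows "cong_ideal I (x - x') (y - y')"
proof -
  have "cong_ideal I (- x') (- y')"
    using cong_ideal_sym[OF assms(1,3)] by (simp add: cong_ideal_def)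
  then show ?thesis
    using cong_ideal_add[OF assms(1,2), of "- x'" "- y'"] by simp
qed

lemma cong_ideal_mult:
  assumes I: "is_ideal I" and "cong_ideal I x y" "cong_ideal I x' y'"
  shows "cong_ideal I (x * x') (y * y')"
proof -
  have "x * (x' - y') \<in> I" "y' * (x - y) \<in> I"
    using assms unfolding cong_ideal_def is_ideal_def by blast+
  then have "x * (x' - y') + y' * (x - y) \<in> I"
    using I unfolding is_ideal_def by blast
  then show ?thesis
    by (simp add: cong_ideal_def algebra_simps)
qed

lemma cong_ideal_power:
  "is_ideal I \<Longrightarrow> cong_ideal I x y \<Longrightarrow> cong_ideal I (x ^ n) (y ^ n)"
  by (induction n) (simp_all add: cong_ideal_refl cong_ideal_mult)

text \<open>
  Every monomial of the trace form contains exactly three factors \<open>F\<close>, so a map that scales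
  \<open>F\<close> by \<open>c\<close> scales the trace form by \<open>c\<^sup>3\<close>.
\<close>

lemma cong_ideal_trace_form:
  assumes I: "is_ideal I"
    and F: "\<And>X Y Z. cong_ideal I (F (g X) (g Y) (g Z)) (c * F X Y Z)"
  shows "cong_ideal I (trace_form F (g a) (g X) (g Y) (g Z)) (c ^ 3 * trace_form F a X Y Z)"
proof -
  have "c ^ 3 * trace_form F a X Y Z =
      27 * (c * F X a a) * (c * F Y a a) * (c * F Z a a)
      - 9 * (c * F a a a) * ((c * F X Y a) * (c * F Z a a) + (c * F Y Z a) * (c * F X a a)
          + (c * F X Z a) * (c * F Y a a))
      + 3 * (c * F a a a) ^ 2 * (c * F X Y Z)"
    by (simp add: trace_form_def algebra_simps power2_eq_square power3_eq_cube)
  moreover have "cong_ideal I (trace_form F (g a) (g X) (g Y) (g Z)) \<dots>"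
    unfolding trace_form_def
    by (intro cong_ideal_add cong_ideal_diff cong_ideal_mult cong_ideal_power I F
        cong_ideal_refl)
  ultimately show ?thesis
    by simp
qed

definition J_one :: "'r :: comm_ring_1 J" where
  "J_one = (\<chi> v. case v of Inl _ \<Rightarrow> 1 | Inr _ \<Rightarrow> 0)"

text \<open>
  The similitude factor is \<open>c(L) = det (L 1)\<close>, because \<open>det 1 = 1\<close> for the identity matrix \<open>1\<close>. This
  makes it polynomial in the entries of \<open>L\<close>, and its cube is the character by which the
  trace forms transform.
\<close>

definition similitude_character :: "('k :: field) oct \<Rightarrow>
    (J_index \<times> J_index + J_index \<times> J_index, 'k) mpoly" where
  "similitude_character A =
     J_det (oct_base_change mpoly_const A) ((\<chi> i j. mpoly_var (Inl (i, j))) *v J_one) ^ 3"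

lemma (in ring_morphism) map_vec_matrix_vector_mult:
  "map_vec h (L *v X) = (\<chi> i. map_vec h (L $ i)) *v map_vec h X"
  by (simp add: vec_eq_iff matrix_vector_mult_def hom_simps)

lemma (in ring_morphism) map_vec_J_one: "map_vec h J_one = J_one"
  by (simp add: vec_eq_iff J_one_def one zero split: sum.split)

lemma GE6_eval_similitude_character:
  fixes A :: "('k :: field) oct"
  shows "GE6_eval (similitude_character A) L L'
     = J_det (oct_base_change mpoly_const A) (L *v J_one) ^ 3"
proof -
  interpret c: ring_morphism "mpoly_const :: 'k \<Rightarrow> 'k scalars"
    by (rule ring_morphism_mpoly_const)
  define \<epsilon> where "\<epsilon> = mpoly_eval (mpoly_const :: 'k \<Rightarrow> 'k scalars)
      (case_sum (\<lambda>(i, j). L $ i $ j) (\<lambda>(i, j). L' $ i $ j))"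
  interpret \<epsilon>: ring_morphism \<epsilon>
    unfolding \<epsilon>_def by (rule c.ring_morphism_mpoly_eval)
  have const: "\<epsilon> \<circ> mpoly_const = mpoly_const"
    by (simp add: fun_eq_iff \<epsilon>_def c.mpoly_eval_const)
  have L: "(\<chi> i. map_vec \<epsilon> (\<chi> j. mpoly_var (Inl (i, j)))) = L"
    by (simp add: vec_eq_iff \<epsilon>_def c.mpoly_eval_var)
  show ?thesis
    unfolding GE6_eval_def \<epsilon>_def[symmetric] similitude_character_def \<epsilon>.power
      \<epsilon>.J_det_base_change[symmetric] const
    by (simp add: \<epsilon>.map_vec_matrix_vector_mult L \<epsilon>.map_vec_J_one)
qed

context octonions
begin

lemma J_det_one: "J_det (oct_base_change mpoly_const A) (J_one :: 'k scalars J) = 1"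
proof -
  have x: "J_x i (J_one :: 'k scalars J) = 0" for i
    by (simp add: J_x_def J_one_def vec_eq_iff)
  interpret quadratic_algebra "oct_base_change (mpoly_const :: 'k \<Rightarrow> 'k scalars) A"
    by (rule quadratic_algebra_base_change)
  have "oct_triple (oct_base_change (mpoly_const :: 'k \<Rightarrow> 'k scalars) A) 0 0 0 = 0"
    using triple_scale(1)[of 0 0 0 0] by simp
  moreover have "oct_norm (oct_base_change (mpoly_const :: 'k \<Rightarrow> 'k scalars) A) 0 = 0"
    using norm_scale[of 0 0] by simp
  ultimately show ?thesis
    by (simp add: J_det_def x oct_triple_def) (simp add: J_one_def J_s_def)
qed

lemma GE6_equivariant_trace_form_poly: "GE6_equivariant A (trace_form_poly A)"
proof -
  let ?A = "oct_base_change mpoly_const A"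
  let ?N = "J_det ?A :: 'k scalars J \<Rightarrow> 'k scalars"
  let ?D = "J_D_over mpoly_const A :: 'k scalars J \<Rightarrow> 'k scalars J \<Rightarrow> 'k scalars J \<Rightarrow> 'k scalars"
  have scale: "cong_ideal I (?N (L *v X)) (?N (L *v J_one) * ?N X)"
    if I: "is_ideal I" and L: "(L, L') \<in> GE6_points A I" for I L L' X
  proof -
    obtain c where c: "cong_ideal I (?N (L *v X)) (c * ?N X)" for X
      using L unfolding GE6_points_def by blast
    have "cong_ideal I c (?N (L *v J_one))"
      using cong_ideal_sym[OF I c[of J_one]] by (simp add: J_det_one)
    then show ?thesis
      by (intro cong_ideal_trans[OF I c] cong_ideal_mult I cong_ideal_refl)
  qed
  have D: "cong_ideal I (?D (L *v X) (L *v Y) (L *v Z)) (?N (L *v J_one) * ?D X Y Z)"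
    if I: "is_ideal I" and L: "(L, L') \<in> GE6_points A I" for I L L' X Y Z
  proof -
    let ?c = "?N (L *v J_one)"
    have eq: "?c * ?D X Y Z = mpoly_const (1 / 6) *
       (?c * ?N (X + Y + Z) - ?c * ?N (X + Y) - ?c * ?N (Y + Z) - ?c * ?N (Z + X)
         + ?c * ?N X + ?c * ?N Y + ?c * ?N Z)"
      unfolding J_D_over_def J_polarization_def by (simp add: algebra_simps)
    show ?thesis
      unfolding eq unfolding J_D_over_def J_polarization_def matrix_vector_right_distrib[symmetric]
      by (intro cong_ideal_mult cong_ideal_add cong_ideal_diff cong_ideal_refl I scale[OF I L])
  qed
  have "GE6_character A (similitude_character A)"
    unfolding GE6_character_def GE6_eval_similitude_character
  proof (intro allI impI conjI ballI, goal_cases)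
    case (1 I)
    then show ?case
      by (simp add: J_det_one cong_ideal_refl)
  next
    case (2 I p)
    show ?case
    proof (clarsimp split: prod.split, goal_cases)
      case (1 L L' M M')
      then show ?case
        using cong_ideal_power[OF \<open>is_ideal I\<close> scale[OF \<open>is_ideal I\<close>, of L L' "M *v J_one"], of 3] 2
        by (simp add: matrix_vector_mul_assoc power_mult_distrib)
    qed
  qed
  moreover have "cong_ideal I
      (J_trilinear mpoly_const (trace_form_poly A) (L *v a) (L *v X) (L *v Y) (L *v Z))
      (GE6_eval (similitude_character A) L L' * J_trilinear mpoly_const (trace_form_poly A) a X Y Z)"
    if "is_ideal I" "(L, L') \<in> GE6_points A I" for I L L' a X Y Z
    unfolding J_trilinear_trace_form_poly[OF ring_morphism_mpoly_const]
      GE6_eval_similitude_character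
    using that by (intro cong_ideal_trace_form D)
  ultimately show ?thesis
    unfolding GE6_equivariant_def by blast
qed

end

section \<open>Identities in octonion algebras\<close>

context octonions
begin

abbreviation mult (infixl "\<cdot>" 70) where "mult \<equiv> oct_mult A"
abbreviation "B \<equiv> oct_polar A"
abbreviation "N \<equiv> oct_norm A"
abbreviation "conjg \<equiv> oct_cnj A"
abbreviation "one \<equiv> oct_one A"

lemma mult_one [simp]: "one \<cdot> x = x" "x \<cdot> one = x"
  using octonion by (auto simp: octonion_algebra_def)

lemma norm_mult: "N (x \<cdot> y) = N x * N y"
  using octonion by (auto simp: octonion_algebra_def)

lemma polar_diff_left: "B (x - y) z = B x z - B y z"
  using polar_add_left[of "x - y" y z] by simp

lemma polar_diff_right: "B z (x - y) = B z x - B z y"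
  unfolding oct_polar_commute[of A z] by (rule polar_diff_left)

lemma mult_diff_left: "(x - y) \<cdot> z = x \<cdot> z - y \<cdot> z"
  using mult_add_left[of "x - y" y z] by (simp add: algebra_simps)

lemma mult_diff_right: "z \<cdot> (x - y) = z \<cdot> x - z \<cdot> y"
  using mult_add_right[of z "x - y" y] by (simp add: algebra_simps)

lemma polar_eqI:
  assumes "\<And>w. B x w = B y w"
  shows "x = y"
proof -
  have "\<forall>w. B (x - y) w = 0"
    using assms by (simp add: polar_diff_left)
  then have "x - y = 0"
    using octonion unfolding octonion_algebra_def by blast
  then show ?thesis
    by simp
qed

lemma norm_one: "N one = 1"
proof -
  obtain x where "N x \<noteq> 0"
  proof (rule ccontr)
    assume "\<not> thesis"
    with that have "N x = 0" for x
      by blast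
    then have "axis 1 1 = (0 :: 'k ^ 8)"
      by (intro polar_eqI) (simp add: oct_polar_def)
    then show False
      by (simp add: axis_eq_0_iff)
  qed
  then show ?thesis
    using norm_mult[of one x] by simp
qed

lemma polar_mult_same_left: "B (x \<cdot> y) (x \<cdot> z) = N x * B y z"
  by (simp add: oct_polar_def mult_add_right[symmetric] norm_mult algebra_simps)

text \<open>
  The linearization of \<open>N (x y) = N x N y\<close> in both arguments; the other identities of
  composition algebras follow from it by specialization and non-degeneracy.
\<close>

lemma polar_mult_exchange: "B (x \<cdot> y) (z \<cdot> w) + B (x \<cdot> w) (z \<cdot> y) = B x z * B y w"
proof -
  have "N (x + z) * B y w = B ((x + z) \<cdot> y) ((x + z) \<cdot> w)"
    by (simp add: polar_mult_same_left)
  then show ?thesis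
    by (simp add: oct_norm_add mult_add_left polar_add_left polar_add_right polar_mult_same_left
        oct_polar_commute[of A "z \<cdot> y"] algebra_simps)
qed

lemma tr_one: "oct_tr A one = 2"
  by (simp add: oct_tr_def polar_self norm_one)

lemma polar_cnj_left: "B (conjg x) y = B x (conjg y)"
  by (simp add: oct_cnj_def oct_tr_def polar_diff_left polar_diff_right polar_scale_left
      polar_scale_right oct_polar_commute[of A one])

lemma cnj_cnj [simp]: "conjg (conjg x) = x"
  using tr_one
  by (simp add: oct_cnj_def oct_tr_def polar_diff_left polar_scale_left)

lemma polar_cnj_cnj: "B (conjg x) (conjg y) = B x y"
  by (simp add: polar_cnj_left)

lemma norm_cnj: "N (conjg x) = N x"
  using polar_self[of x] polar_self[of "conjg x"] two by (simp add: polar_cnj_cnj)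

lemma cnj_add: "conjg (x + y) = conjg x + conjg y"
  by (simp add: oct_cnj_def oct_tr_def polar_add_left vec_eq_iff algebra_simps)

lemma cnj_diff: "conjg (x - y) = conjg x - conjg y"
  by (simp add: oct_cnj_def oct_tr_def polar_diff_left vec_eq_iff algebra_simps)

lemma cnj_scale: "conjg (c *s x) = c *s conjg x"
  by (simp add: oct_cnj_def oct_tr_def polar_scale_left vec_eq_iff algebra_simps)

lemma polar_mult_left: "B (x \<cdot> y) w = B y (conjg x \<cdot> w)"
  using polar_mult_exchange[of x y one w]
  by (simp add: oct_cnj_def oct_tr_def mult_diff_left mult_scale_left polar_diff_right
      polar_scale_right oct_polar_commute[of A y] algebra_simps)

lemma polar_mult_right: "B (x \<cdot> y) w = B x (w \<cdot> conjg y)"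
  using polar_mult_exchange[of x y w one]
  by (simp add: oct_cnj_def oct_tr_def mult_diff_right mult_scale_right polar_diff_right
      polar_scale_right algebra_simps)

lemma cnj_mult: "conjg (x \<cdot> y) = conjg y \<cdot> conjg x"
proof (rule polar_eqI)
  fix w
  have "B (conjg (x \<cdot> y)) w = B y (conjg x \<cdot> conjg w)"
    by (simp add: polar_cnj_left polar_mult_left)
  also have "\<dots> = B (conjg x) (y \<cdot> w)"
    by (simp add: oct_polar_commute[of A y] polar_mult_right)
  also have "\<dots> = B (conjg y \<cdot> conjg x) w"
    by (simp add: polar_mult_left)
  finally show "B (conjg (x \<cdot> y)) w = B (conjg y \<cdot> conjg x) w" .
qed

lemma cnj_mult_mult: "conjg x \<cdot> (x \<cdot> y) = N x *s y"
  by (rule polar_eqI)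
    (simp only: polar_mult_left[of "conjg x"] cnj_cnj polar_mult_same_left polar_scale_left)

lemma mult_cnj_mult: "x \<cdot> (conjg x \<cdot> y) = N x *s y"
  using cnj_mult_mult[of "conjg x" y] by (simp add: norm_cnj)

lemma mult_mult_cnj: "y \<cdot> x \<cdot> conjg x = N x *s y"
  using arg_cong[OF mult_cnj_mult[of x "conjg y"], of conjg]
  by (simp add: cnj_mult cnj_scale)

lemma mult_cnj_add: "x \<cdot> conjg y + y \<cdot> conjg x = B x y *s one"
proof (rule polar_eqI)
  fix w
  have "B (x \<cdot> conjg y + y \<cdot> conjg x) w = B (one \<cdot> x) (w \<cdot> y) + B (one \<cdot> y) (w \<cdot> x)"
    by (simp add: polar_add_left polar_mult_right)
  also have "\<dots> = B (B x y *s one) w"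
    by (simp only: polar_mult_exchange) (simp add: polar_scale_left)
  finally show "B (x \<cdot> conjg y + y \<cdot> conjg x) w = B (B x y *s one) w" .
qed

lemma cnj_mult_add: "conjg x \<cdot> y + conjg y \<cdot> x = B x y *s one"
  using mult_cnj_add[of "conjg x" "conjg y"] by (simp add: polar_cnj_cnj)

text \<open>
  The right side is \<open>tr(x (y z)) x - N(x) conjg (y z) = x (y z) x\<close>, so this is the middle Moufang
  identity, in the form in which it enters the adjoint identity.
\<close>

lemma middle_moufang: "(x \<cdot> y) \<cdot> (z \<cdot> x) = B x (conjg (y \<cdot> z)) *s x - N x *s conjg (y \<cdot> z)"
proof (rule polar_eqI)
  fix w
  have "B ((x \<cdot> y) \<cdot> (z \<cdot> x)) w = B (x \<cdot> y) (w \<cdot> (conjg x \<cdot> conjg z))"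
    by (simp add: polar_mult_right cnj_mult)
  also have "\<dots> = B x w * B y (conjg x \<cdot> conjg z) - B (x \<cdot> (conjg x \<cdot> conjg z)) (w \<cdot> y)"
    by (simp add: polar_mult_exchange[symmetric])
  also have "B (x \<cdot> (conjg x \<cdot> conjg z)) (w \<cdot> y) = N x * B (conjg (y \<cdot> z)) w"
    by (simp add: mult_cnj_mult polar_scale_left cnj_mult polar_mult_right)
  also have "B y (conjg x \<cdot> conjg z) = B (x \<cdot> y) (conjg z)"
    by (simp only: polar_mult_left)
  also have "\<dots> = B x (conjg (y \<cdot> z))"
    by (simp only: polar_mult_right cnj_mult)
  finally show "B ((x \<cdot> y) \<cdot> (z \<cdot> x)) w = B (B x (conjg (y \<cdot> z)) *s x - N x *s conjg (y \<cdot> z)) w"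
    by (simp add: polar_diff_left polar_scale_left algebra_simps)
qed

lemma triple_eq: "oct_triple A x y z = B x (conjg (y \<cdot> z))"
  by (simp add: oct_triple_def oct_tr_def polar_mult_right cnj_mult)

lemma triple_cyclic: "oct_triple A x y z = oct_triple A y z x"
proof -
  have "B x (conjg (y \<cdot> z)) = B (x \<cdot> y) (conjg z)"
    by (simp only: cnj_mult polar_mult_right)
  also have "\<dots> = B y (conjg (z \<cdot> x))"
    by (simp only: cnj_mult polar_mult_left)
  finally show ?thesis
    by (simp only: triple_eq)
qed

end

section \<open>Cubic forms with an adjoint\<close>

text \<open>
  Polarization of quartic forms. The values of the form at \<open>a + x\<close>, \<open>a - x\<close> and \<open>a + 2x\<close> give
  linear equations for its three mixed terms in \<open>a\<close> and \<open>x\<close>, which can be solved by dividing by 2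
  and 3 only.
\<close>

locale symmetric_quartic =
  fixes q :: "'v :: ab_group_add \<Rightarrow> 'v \<Rightarrow> 'v \<Rightarrow> 'v \<Rightarrow> 'k :: field"
  assumes add: "q (x + x') y z w = q x y z w + q x' y z w"
    and swap12: "q x y z w = q y x z w"
    and swap23: "q x y z w = q x z y w"
    and swap34: "q x y z w = q x y w z"
begin

lemma add2: "q y (x + x') z w = q y x z w + q y x' z w"
  unfolding swap12[of y] by (rule add)

lemma add3: "q y z (x + x') w = q y z x w + q y z x' w"
  unfolding swap23[of y z] by (rule add2)

lemma add4: "q y z w (x + x') = q y z w x + q y z w x'"
  unfolding swap34[of y z w] by (rule add3)

lemma diagonal_add:
  "q (a + x) (a + x) (a + x) (a + x)
     = q a a a a + 4 * q a a a x + 6 * q a a x x + 4 * q a x x x + q x x x x"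
  by (simp add: add add2 add3 add4 swap12[of x a] swap23[of _ x a] swap34[of _ _ x a])

lemma polarization:
  assumes zero: "\<And>x. q x x x x = 0" and two: "(2 :: 'k) \<noteq> 0" and three: "(3 :: 'k) \<noteq> 0"
  shows "q a a a x = 0" "q a a x y = 0"
proof -
  have uminus2: "q y (- x) z w = - q y x z w" for x y z w
    using add2[of y x "- x" z w] add2[of y 0 0 z w] by (simp add: eq_neg_iff_add_eq_0 add.commute)
  have uminus3: "q y z (- x) w = - q y z x w" for x y z w
    unfolding swap23[of y z] by (rule uminus2)
  have uminus4: "q y z w (- x) = - q y z w x" for x y z w
    unfolding swap34[of y z w] by (rule uminus3)
  have 1: "4 * q a a a x + 6 * q a a x x + 4 * q a x x x = 0" for x
    using diagonal_add[of a x] by (simp add: zero)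
  have 2: "- (4 * q a a a x) + 6 * q a a x x - 4 * q a x x x = 0" for x
    using 1[of "- x"] by (simp add: uminus2 uminus3 uminus4)
  have 3: "8 * q a a a x + 24 * q a a x x + 32 * q a x x x = 0" for x
    using 1[of "x + x"] by (simp add: add2 add3 add4 algebra_simps)
  have "2 * 2 * 3 * q a a x x = 0" for x
    using 1[of x] 2[of x] by algebra
  then have 22: "q a a x x = 0" for x
    using two three by (metis mult_eq_0_iff)
  have "2 * 2 * 2 * 3 * q a a a x = 0"
    using 1[of x] 3[of x] 22[of x] by algebra
  then show "q a a a x = 0"
    using two three by (metis mult_eq_0_iff)
  have "2 * q a a x y = 0"
    using 22[of "x + y"] swap34[of a a y x] by (simp add: 22 add3 add4)
  then show "q a a x y = 0"
    using two by simp
qed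

end

text \<open>
  A cubic form \<open>D(X,X,X)\<close> with a pairing and the adjoint map \<open>X \<mapsto> X \<times> X\<close> which satisfies the
  adjoint identity \<open>(X \<times> X) \<times> (X \<times> X) = D(X,X,X) X\<close>. Everything about the isotopes depends on
  this structure only.
\<close>

locale cubic_adjoint = D: symmetric_trilinear D
  for D :: "('k :: field) ^ ('n :: finite) \<Rightarrow> 'k ^ 'n \<Rightarrow> 'k ^ 'n \<Rightarrow> 'k" +
  fixes ip :: "'k ^ 'n \<Rightarrow> 'k ^ 'n \<Rightarrow> 'k"
    and cross :: "'k ^ 'n \<Rightarrow> 'k ^ 'n \<Rightarrow> 'k ^ 'n"
  assumes two: "(2 :: 'k) \<noteq> 0" and three: "(3 :: 'k) \<noteq> 0"
    and ip_add: "ip (X + Y) Z = ip X Z + ip Y Z"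
    and ip_commute: "ip X Y = ip Y X"
    and ip_nondegenerate: "(\<And>Z. ip X Z = 0) \<Longrightarrow> X = 0"
    and ip_cross: "ip (cross X Y) Z = 3 * D X Y Z"
    and adjoint: "ip (cross (cross X X) (cross X X)) Y = D X X X * ip X Y"
begin

lemma ip_eqI:
  assumes "\<And>Z. ip X Z = ip Y Z"
  shows "X = Y"
proof -
  have "ip (X - Y) Z = 0" for Z
    using ip_add[of "X - Y" Y Z] assms by simp
  then show ?thesis
    using ip_nondegenerate[of "X - Y"] by simp
qed

lemma cross_commute: "cross X Y = cross Y X"
  by (rule ip_eqI) (simp add: ip_cross D.swap12[of X])

lemma cross_add: "cross (X + Y) Z = cross X Z + cross Y Z"
  by (rule ip_eqI) (simp add: ip_cross ip_add D.add algebra_simps)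

lemma D_eq_ip: "3 * D X Y Z = ip X (cross Y Z)"
  unfolding ip_commute[of X] ip_cross D.swap12[of X] D.swap23[of Y X] ..

text \<open>
  Twelve times the symmetric 4-linear map whose diagonal is \<open>(X \<times> X) \<times> (X \<times> X) - D(X,X,X) X\<close>, paired with
  \<open>v\<close>. Pairing keeps all computations inside the field, and \<open>3 D\<close> replaces the outermost cross
  product.
\<close>

definition adjoint_defect where
  "adjoint_defect v x y z w = 12 * (D (cross x y) (cross z w) v + D (cross x z) (cross y w) v
      + D (cross x w) (cross y z) v)
    - 3 * (D x y z * ip w v + D x y w * ip z v + D x z w * ip y v + D y z w * ip x v)"

lemma symmetric_quartic_adjoint_defect: "symmetric_quartic (adjoint_defect v)"
proof
  show "adjoint_defect v (x + x') y z w = adjoint_defect v x y z w + adjoint_defect v x' y z w"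
    for x x' y z w
    unfolding adjoint_defect_def cross_add D.add ip_add
      D.swap12[of "cross y _"] by (simp add: D.add cross_add ip_add algebra_simps)
  show "adjoint_defect v x y z w = adjoint_defect v y x z w" for x y z w
    unfolding adjoint_defect_def cross_commute[of y x] D.swap12[of y x]
      D.swap12[of "cross y z"] D.swap12[of "cross y w"]
    by (simp add: algebra_simps)
  show "adjoint_defect v x y z w = adjoint_defect v x z y w" for x y z w
    unfolding adjoint_defect_def cross_commute[of z y] D.swap12[of z y] D.swap23[of x z y]
    by (simp add: algebra_simps)
  show "adjoint_defect v x y z w = adjoint_defect v x y w z" for x y z w
    unfolding adjoint_defect_def cross_commute[of w z] D.swap23[of _ w z]
    by (simp add: algebra_simps)
qed

lemma adjoint_defect_diagonal: "adjoint_defect v x x x x = 0"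
  using ip_cross[of "cross x x" "cross x x" v] adjoint[of x v]
  by (simp add: adjoint_defect_def)

lemmas adjoint_defect_eq_0 =
  symmetric_quartic.polarization[OF symmetric_quartic_adjoint_defect adjoint_defect_diagonal
    two three]

text \<open>
  The derivative of the adjoint identity in the direction \<open>X\<close>.
\<close>

lemma cross_adjoint_cross:
  "12 * D (cross a a) (cross X a) Y = 3 * D X a a * ip a Y + D a a a * ip X Y"
proof -
  have "3 * (12 * D (cross a a) (cross X a) Y) = 3 * (3 * D X a a * ip a Y + D a a a * ip X Y)"
    using adjoint_defect_eq_0(1)[of Y a X]
    unfolding adjoint_defect_def cross_commute[of a X] D.swap12[of a X] D.swap23[of a a X]
      D.swap12[of "cross X a"]
    by (simp add: algebra_simps D.swap12[of a X])
  then show ?thesis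
    using three by (simp only: mult_cancel_left) simp
qed

text \<open>
  The second derivative of the adjoint identity expresses \<open>(X \<times> a) \<times> (Y \<times> a)\<close> through
  \<open>(a \<times> a) \<times> (X \<times> Y)\<close>; paired with \<open>Z \<times> a\<close>, the latter is known from the first derivative. This removes the
  cross products from the trace form.
\<close>

lemma cross_cross_cross:
  "24 * D (cross X a) (cross Y a) (cross Z a) =
     9 * (D X Y a * D Z a a + D Y Z a * D X a a + D X Z a * D Y a a) - 3 * D a a a * D X Y Z"
proof -
  have 1: "12 * D (cross a a) (cross X Y) (cross Z a)
      = 9 * D Z a a * D X Y a + 3 * D a a a * D X Y Z"
  proof -
    have "ip a (cross X Y) = 3 * D X Y a" "ip Z (cross X Y) = 3 * D X Y Z"
      by (simp_all add: ip_commute[of _ "cross X Y"] ip_cross)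
    then show ?thesis
      using cross_adjoint_cross[of a Z "cross X Y"]
      by (simp add: D.swap23[of _ "cross X Y"] algebra_simps)
  qed
  have 2: "ip X (cross Z a) = 3 * D X Z a" "ip Y (cross Z a) = 3 * D Y Z a"
    "ip a (cross Z a) = 3 * D Z a a"
    by (simp_all add: D_eq_ip[symmetric] D.swap12[of a Z])
  have 3: "D a a X = D X a a" "D a a Y = D Y a a" "D a X Y = D X Y a"
    unfolding D.swap23[of a a X] D.swap23[of a a Y] D.swap12[of a X] D.swap12[of a Y]
      D.swap23[of X a Y] by simp_all
  \<comment> \<open>\<open>p\<close> is \<open>D(a \<times> a, X \<times> Y, Z \<times> a)\<close>, eliminated by the first derivative; \<open>K\<close> is the value sought.\<close>
  have solve: "24 * K = 3 * r - s" if "12 * (p + (K + K)) - 3 * r = 0" "12 * p = s" for p K r s :: 'k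
    using that by algebra
  have "24 * D (cross X a) (cross Y a) (cross Z a)
      = 3 * (D X a a * (3 * D Y Z a) + D Y a a * (3 * D X Z a) + 2 * D X Y a * (3 * D Z a a))
        - (9 * D Z a a * D X Y a + 3 * D a a a * D X Y Z)"
  proof (rule solve[OF _ 1])
    show "12 * (D (cross a a) (cross X Y) (cross Z a)
        + (D (cross X a) (cross Y a) (cross Z a) + D (cross X a) (cross Y a) (cross Z a)))
        - 3 * (D X a a * (3 * D Y Z a) + D Y a a * (3 * D X Z a) + 2 * D X Y a * (3 * D Z a a)) = 0"
      using adjoint_defect_eq_0(2)[of "cross Z a" a X Y]
      unfolding adjoint_defect_def 2 3 cross_commute[of a X] cross_commute[of a Y] D.swap12[of "cross Y a" "cross X a"]
      by (simp add: algebra_simps)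
  qed
  then show ?thesis
    by (simp add: algebra_simps)
qed

definition Q where
  "Q a X Y = - 6 * D a a a * D X Y a + 9 * D X a a * D Y a a"

text \<open>
  For \<open>D(a,a,a) = 1\<close> this is the product of the isotope; in general it is \<open>D(a,a,a)\<close> times
  that product. It has degree two in \<open>a\<close>.
\<close>

definition isotope_product where
  "isotope_product a X Y = 4 *s cross (cross X a) (cross Y a) - (3 * D X Y a) *s a"

lemma D_diff: "D (X - X') Y Z = D X Y Z - D X' Y Z"
  using D.add[of "X - X'" X' Y Z] by simp

lemma Q_diff: "Q a (X - X') Y = Q a X Y - Q a X' Y"
  by (simp add: Q_def D_diff algebra_simps)

lemma Q_scale: "Q a (c *s X) Y = c * Q a X Y"
  by (simp add: Q_def D.scale algebra_simps)

text \<open>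
  If \<open>Q\<^sub>a(X,-) = 0\<close>, then pairing with \<open>a\<close> gives \<open>D(X,a,a) = 0\<close>, hence \<open>X \<times> a = 0\<close>, and the derivative
  of the adjoint identity recovers \<open>D(a,a,a) X\<close> from \<open>X \<times> a\<close> and \<open>D(X,a,a)\<close>.
\<close>

lemma Q_nondegenerate:
  assumes a: "D a a a \<noteq> 0" and Q: "\<And>Z. Q a X Z = 0"
  shows "X = 0"
proof -
  have "3 * D a a a * D X a a = 0"
    using Q[of a] by (simp add: Q_def algebra_simps)
  then have Xaa: "D X a a = 0"
    using a three by simp
  have six: "(6 :: 'k) \<noteq> 0"
    using field_6_nonzero two three .
  have XZa: "D X Z a = 0" for Z
    using Q[of Z] a Xaa six by (simp add: Q_def)
  show ?thesis
  proof (rule ip_nondegenerate)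
    fix Z
    have "3 * D (cross a a) (cross X a) Z = ip (cross X a) (cross (cross a a) Z)"
      by (simp add: D_eq_ip[symmetric] D.swap12[of "cross a a"])
    also have "\<dots> = 0"
      by (simp add: ip_cross D.swap23[of X a] XZa)
    finally have "D (cross a a) (cross X a) Z = 0"
      using three by simp
    then show "ip X Z = 0"
      using cross_adjoint_cross[of a X Z] Xaa a by simp
  qed
qed

text \<open>
  The form \<open>Q\<^sub>a\<close> pairs \<open>(X \<times> a) \<times> (Y \<times> a)\<close> with \<open>Z\<close> only through \<open>D(X \<times> a, Y \<times> a, Z \<times> a)\<close> and its
  special case \<open>Z = a\<close>.
\<close>

lemma Q_isotope_product: "Q a (isotope_product a X Y) Z = trace_form D a X Y Z"
proof -
  let ?C = "cross (cross X a) (cross Y a)"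
  have C: "D ?C Z a = D (cross X a) (cross Y a) (cross Z a)" for Z
  proof -
    have "3 * D ?C Z a = 3 * D (cross X a) (cross Y a) (cross Z a)"
      by (simp add: D_eq_ip[of ?C] ip_cross)
    then show ?thesis
      using three by simp
  qed
  have "6 * (4 * D ?C a a) = 6 * (D a a a * D X Y a + 3 * D X a a * D Y a a)"
    unfolding C using cross_cross_cross[of X a Y a] by (simp add: algebra_simps)
  moreover have "(6 :: 'k) \<noteq> 0"
    using field_6_nonzero two three .
  ultimately have Caa: "4 * D ?C a a = D a a a * D X Y a + 3 * D X a a * D Y a a"
    by (simp only: mult_cancel_left) simp
  have "Q a (isotope_product a X Y) Z
      = - (D a a a * (24 * D ?C Z a)) + 9 * (4 * D ?C a a) * D Z a a
        - 9 * D a a a * D X Y a * D Z a a"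
    by (simp add: isotope_product_def Q_diff Q_scale) (simp add: Q_def D.swap12[of a Z] algebra_simps)
  also have "\<dots> = trace_form D a X Y Z"
    unfolding Caa C[of Z] cross_cross_cross trace_form_def by (simp add: algebra_simps power2_eq_square)
  finally show ?thesis .
qed

end

section \<open>The exceptional Jordan algebra\<close>

definition J_of :: "(3 \<Rightarrow> 'r) \<Rightarrow> (3 \<Rightarrow> 'r ^ 8) \<Rightarrow> 'r J" where
  "J_of s x = (\<chi> v. case v of Inl i \<Rightarrow> s i | Inr (i, j) \<Rightarrow> x i $ j)"

lemma J_s_of [simp]: "J_s i (J_of s x) = s i"
  by (simp add: J_s_def J_of_def)

lemma J_x_of [simp]: "J_x i (J_of s x) = x i"
  by (simp add: J_x_def J_of_def vec_eq_iff)

lemma J_eqI: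
  assumes "\<And>i. J_s i X = J_s i Y" "\<And>i. J_x i X = J_x i Y"
  shows "X = Y"
proof -
  have "X $ v = Y $ v" for v
    using assms by (cases v) (auto simp: J_s_def J_x_def vec_eq_iff)
  then show ?thesis
    by (simp add: vec_eq_iff)
qed

text \<open>
  The three indices are permuted cyclically. Named functions are used in place of \<open>i + 1\<close> and
  \<open>i + 2\<close>, since arithmetic on numerals would merge sums such as \<open>i + 2 + 1\<close> into \<open>i + 3\<close>
  and hide the equality with \<open>i\<close>.
\<close>

definition next_index :: "3 \<Rightarrow> 3" where
  "next_index i = i + 1"

definition prev_index :: "3 \<Rightarrow> 3" where
  "prev_index i = i + 2"

lemma next_prev_numeral [simp]:
  "next_index 1 = 2" "next_index 2 = 3" "next_index 3 = 1"
  "prev_index 1 = 3" "prev_index 2 = 1" "prev_index 3 = 2"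
  by (simp_all add: next_index_def prev_index_def)

lemma next_prev_index [simp]:
  "next_index (next_index i) = prev_index i" "next_index (prev_index i) = i"
  "prev_index (next_index i) = i" "prev_index (prev_index i) = next_index i"
  using exhaust_3[of i] by auto

context octonions
begin

lemma one_nonzero: "one \<noteq> 0"
  using norm_one norm_scale[of 0 0] by auto

lemma J_matrix_inject:
  assumes "J_matrix A X = J_matrix A Y"
  shows "X = Y"
proof -
  have "J_s 1 X = J_s 1 Y" "J_s 2 X = J_s 2 Y" "J_s 3 X = J_s 3 Y"
    "J_x 1 X = J_x 1 Y" "J_x 2 X = J_x 2 Y" "J_x 3 X = J_x 3 Y"
    using assms by (simp_all add: J_matrix_def vec_eq_iff[where 'b = 3] forall_3 one_nonzero)
  then show ?thesis
    by (intro J_eqI) (metis exhaust_3)+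
qed

text \<open>
  The symmetrized matrix product is again Hermitian with scalar diagonal, so it is the matrix
  of an element of the algebra. On the diagonal
  this rests on \<open>x (conjg y) + y (conjg x) = (B x y) 1\<close>.
\<close>

lemma J_mult_eq:
  "J_mult A X Y = J_of
     (\<lambda>i. J_s i X * J_s i Y
       + (B (J_x (next_index i) X) (J_x (next_index i) Y) + B (J_x (prev_index i) X) (J_x (prev_index i) Y)) / 2)
     (\<lambda>i. (1 / 2) *s (J_s (next_index i) X *s J_x i Y + J_s (prev_index i) Y *s J_x i X
       + J_s (next_index i) Y *s J_x i X + J_s (prev_index i) X *s J_x i Y
       + conjg (J_x (next_index i) Y \<cdot> J_x (prev_index i) X) + conjg (J_x (next_index i) X \<cdot> J_x (prev_index i) Y)))"
    (is "_ = ?Z")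
  unfolding J_mult_def
proof (rule the_equality)
  have mult_cnj: "x \<cdot> conjg y = B x y *s one - y \<cdot> conjg x"
    "conjg x \<cdot> y = B x y *s one - conjg y \<cdot> x" for x y
    using mult_cnj_add[of x y] cnj_mult_add[of x y] by (simp_all add: eq_diff_eq)
  show *: "J_matrix A ?Z = (\<chi> i j. (1 / 2) *s (oct_matrix_mult A (J_matrix A X) (J_matrix A Y)
                        + oct_matrix_mult A (J_matrix A Y) (J_matrix A X)) $ i $ j)"
    unfolding J_matrix_def oct_matrix_mult_def using two
    by (simp add: vec_eq_iff[where 'b = 3] forall_3 sum_3 cnj_mult cnj_add cnj_scale
        mult_scale_left mult_scale_right mult_cnj[of "J_x i X" "J_x i Y" for i])
      (simp add: vec_eq_iff field_simps)
  show "Z = ?Z" if "J_matrix A Z = (\<chi> i j. (1 / 2) *s (oct_matrix_mult A (J_matrix A X) (J_matrix A Y)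
                        + oct_matrix_mult A (J_matrix A Y) (J_matrix A X)) $ i $ j)" for Z
    using that * by (intro J_matrix_inject) simp
qed

lemma J_inner_eq: "J_inner A X Y = (\<Sum>i\<in>UNIV. J_s i X * J_s i Y + B (J_x i X) (J_x i Y))"
proof -
  have halves: "(b + c) / 2 + (c + a) / 2 + (a + b) / 2 = a + b + c" for a b c :: 'k
    using two by (simp add: add_divide_distrib[symmetric] divide_eq_eq algebra_simps)
  show ?thesis
    using halves[of "B (J_x 2 X) (J_x 2 Y)" "B (J_x 3 X) (J_x 3 Y)" "B (J_x 1 X) (J_x 1 Y)"]
    by (simp add: J_inner_def J_Tr_def J_mult_eq sum_3) (simp add: algebra_simps)
qed

lemma J_inner_add: "J_inner A (X + Y) Z = J_inner A X Z + J_inner A Y Z"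
  by (simp add: J_inner_eq J_s_add J_x_add polar_add_left algebra_simps sum.distrib)

lemma J_inner_scale: "J_inner A (c *s X) Z = c * J_inner A X Z"
  by (simp add: J_inner_eq J_s_scale J_x_scale polar_scale_left algebra_simps sum_distrib_left)

lemma J_inner_commute: "J_inner A X Y = J_inner A Y X"
  unfolding J_inner_eq using oct_polar_commute[of A "J_x i X" "J_x i Y" for i]
  by (simp add: mult.commute)

lemma J_inner_nondegenerate:
  assumes "\<And>Z. J_inner A X Z = 0"
  shows "X = 0"
proof (rule J_eqI)
  fix i
  have zero: "B x 0 = 0" for x
    using polar_scale_right[of x 0 0] by simp
  have "J_inner A X (J_of (\<lambda>j. if j = i then 1 else 0) (\<lambda>_. 0)) = J_s i X"
    by (simp add: J_inner_eq if_distrib[of "(*) _"] zero cong: if_cong)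
  then show "J_s i X = J_s i 0"
    using assms by (simp add: J_s_def)
  have "B (J_x i X) w = 0" for w
  proof -
    have "J_inner A X (J_of (\<lambda>_. 0) (\<lambda>j. if j = i then w else 0)) = B (J_x i X) w"
      by (simp add: J_inner_eq if_distrib[of "B _"] zero cong: if_cong)
    then show ?thesis
      using assms by simp
  qed
  then have "J_x i X = 0"
    by (intro polar_eqI) (simp add: oct_polar_commute[of A 0] zero)
  then show "J_x i X = J_x i 0"
    by (simp add: J_x_def vec_eq_iff)
qed

text \<open>
  The formula is read off from the gradient of the determinant: cyclic invariance of the
  trace of \<open>x y z\<close> allows each of the three factors to be isolated. Non-degeneracy of the
  inner product makes it the only solution.
\<close>

lemma
  shows J_cross_eq: "J_cross A X Y = J_of
     (\<lambda>i. (J_s (next_index i) X * J_s (prev_index i) Y + J_s (next_index i) Y * J_s (prev_index i) X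
       - B (J_x i X) (J_x i Y)) / 2)
     (\<lambda>i. (1 / 2) *s (conjg (J_x (next_index i) X \<cdot> J_x (prev_index i) Y)
       + conjg (J_x (next_index i) Y \<cdot> J_x (prev_index i) X)
       - J_s i X *s J_x i Y - J_s i Y *s J_x i X))" (is "_ = ?W")
    and J_inner_cross: "J_inner A (J_cross A X Y) Z = 3 * J_D A X Y Z"
proof -
  have triple: "oct_triple A x y z = B (conjg (y \<cdot> z)) x"
    "oct_triple A x y z = B (conjg (x \<cdot> y)) z"
    "oct_triple A x y z = B (conjg (z \<cdot> x)) y" for x y z
    by (metis triple_cyclic triple_eq oct_polar_commute)+
  have W: "J_inner A ?W Z = 3 * J_D A X Y Z" for Z
  proof -
    have V: "2 *s ?W = J_of
        (\<lambda>i. J_s (next_index i) X * J_s (prev_index i) Y + J_s (next_index i) Y * J_s (prev_index i) X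
          - B (J_x i X) (J_x i Y))
        (\<lambda>i. conjg (J_x (next_index i) X \<cdot> J_x (prev_index i) Y)
          + conjg (J_x (next_index i) Y \<cdot> J_x (prev_index i) X)
          - J_s i X *s J_x i Y - J_s i Y *s J_x i X)" (is "_ = ?V")
      using two by (intro J_eqI) (simp_all add: J_s_scale J_x_scale)
    have "J_inner A ?V Z = J_polarization A X Y Z"
      unfolding J_polarization_eq J_inner_eq J_mixed_def
      by (simp add: sum_3 polar_add_left polar_diff_left polar_scale_left algebra_simps
        triple(1)[of "J_x 1 Z"] triple(2)[of _ _ "J_x 3 Z"] triple(3)[of _ "J_x 2 Z"])
    then have "2 * J_inner A ?W Z = J_polarization A X Y Z"
      unfolding V[symmetric] J_inner_scale .
    moreover have "2 * (3 * J_D A X Y Z) = J_polarization A X Y Z"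
      using six by (simp add: J_D_def J_polarization_def)
    ultimately have "2 * J_inner A ?W Z = 2 * (3 * J_D A X Y Z)"
      by simp
    then show ?thesis
      using two by (simp only: mult_cancel_left) simp
  qed
  show eq: "J_cross A X Y = ?W"
    unfolding J_cross_def
  proof (rule the_equality)
    show "\<forall>Z. J_inner A ?W Z = 3 * J_D A X Y Z"
      using W by simp
    show "V = ?W" if "\<forall>Z. J_inner A V Z = 3 * J_D A X Y Z" for V
    proof -
      have "J_inner A (V - ?W) Z = 0" for Z
        using J_inner_add[of "V - ?W" ?W Z] that W[of Z] by simp
      then show ?thesis
        using J_inner_nondegenerate[of "V - ?W"] by simp
    qed
  qed
  show "J_inner A (J_cross A X Y) Z = 3 * J_D A X Y Z"
    unfolding eq by (rule W)
qed

lemma J_det_cyclic: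
  "J_det A X = J_s i X * J_s (next_index i) X * J_s (prev_index i) X
     + oct_triple A (J_x i X) (J_x (next_index i) X) (J_x (prev_index i) X)
     - J_s i X * N (J_x i X) - J_s (next_index i) X * N (J_x (next_index i) X)
     - J_s (prev_index i) X * N (J_x (prev_index i) X)"
  using exhaust_3[of i] triple_cyclic[of "J_x 1 X" "J_x 2 X" "J_x 3 X"]
    triple_cyclic[of "J_x 2 X" "J_x 3 X" "J_x 1 X"]
  by (auto simp: J_det_def oct_triple_def[symmetric] sum_3 algebra_simps)

lemma J_cross_self: "J_cross A X X = J_of
     (\<lambda>i. J_s (next_index i) X * J_s (prev_index i) X - N (J_x i X))
     (\<lambda>i. conjg (J_x (next_index i) X \<cdot> J_x (prev_index i) X) - J_s i X *s J_x i X)"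
  using two by (intro J_eqI) (simp_all add: J_cross_eq polar_self vec_eq_iff field_simps)

lemma norm_diff_scale: "N (x - c *s y) = N x - c * B x y + c\<^sup>2 * N y"
  using oct_norm_add[of A x "(- c) *s y"] polar_scale_right[of x "- c" y] norm_scale[of "- c" y]
  by (simp add: algebra_simps)

text \<open>
  The diagonal entries follow from multiplicativity of the norm. An off-diagonal entry contains
  the product \<open>(x y) (z x)\<close>, which the middle Moufang identity turns into the trace term of the
  determinant times \<open>x\<close>, and the remaining terms cancel or give \<open>s\<^sub>i N x\<^sub>i\<close> times \<open>x\<close>.
\<close>

lemma J_adjoint: "J_cross A (J_cross A X X) (J_cross A X X) = J_det A X *s X"
proof (rule J_eqI)
  fix i
  let ?a = "J_s i X" and ?b = "J_s (next_index i) X" and ?c = "J_s (prev_index i) X"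
  let ?x = "J_x i X" and ?y = "J_x (next_index i) X" and ?z = "J_x (prev_index i) X"
  \<comment> \<open>The determinant is written starting from the index \<open>i\<close>, so one computation serves all \<open>i\<close>.\<close>
  note det = J_det_cyclic[of X i]
  have t: "oct_triple A ?x ?y ?z = B (conjg (?y \<cdot> ?z)) ?x"
    by (simp add: triple_eq oct_polar_commute[of A ?x])
  show "J_s i (J_cross A (J_cross A X X) (J_cross A X X)) = J_s i (J_det A X *s X)"
    unfolding J_cross_self[of "J_cross A X X"] unfolding J_cross_self
    unfolding J_s_scale det t
    by (simp add: norm_diff_scale norm_cnj norm_mult algebra_simps
        power2_eq_square)
  have "conjg ((conjg (?z \<cdot> ?x) - ?b *s ?y) \<cdot> (conjg (?x \<cdot> ?y) - ?c *s ?z))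
      = (?x \<cdot> ?y - ?c *s conjg ?z) \<cdot> (?z \<cdot> ?x - ?b *s conjg ?y)"
    by (simp add: cnj_mult cnj_diff cnj_scale)
  also have "\<dots> = (?x \<cdot> ?y) \<cdot> (?z \<cdot> ?x) - (?b * N ?y) *s ?x - (?c * N ?z) *s ?x
      + (?b * ?c) *s conjg (?y \<cdot> ?z)"
    by (simp add: mult_diff_left mult_diff_right mult_scale_left mult_scale_right
        cnj_mult_mult mult_mult_cnj cnj_mult[of ?y ?z] vec_eq_iff algebra_simps)
  finally have 1: "conjg ((conjg (?z \<cdot> ?x) - ?b *s ?y) \<cdot> (conjg (?x \<cdot> ?y) - ?c *s ?z))
      = B ?x (conjg (?y \<cdot> ?z)) *s ?x - N ?x *s conjg (?y \<cdot> ?z)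
       - (?b * N ?y) *s ?x - (?c * N ?z) *s ?x + (?b * ?c) *s conjg (?y \<cdot> ?z)"
    by (simp add: middle_moufang)
  show "J_x i (J_cross A (J_cross A X X) (J_cross A X X)) = J_x i (J_det A X *s X)"
    unfolding J_cross_self[of "J_cross A X X"] unfolding J_cross_self
    unfolding J_x_scale det triple_eq by (simp add: 1) (simp add: vec_eq_iff algebra_simps)
qed

sublocale cubic_adjoint "J_D A" "J_inner A" "J_cross A"
proof -
  interpret D: symmetric_trilinear "J_D A"
    by (rule symmetric_trilinear_J_D)
  show "cubic_adjoint (J_D A) (J_inner A) (J_cross A)"
    by unfold_locales
      (auto simp: two three J_inner_add J_inner_cross J_adjoint J_inner_scale J_D_diagonal
        intro: J_inner_commute J_inner_nondegenerate)
qed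

lemma J_Q_eq: "J_Q A a X Y = Q a X Y"
  by (simp add: J_Q_def Q_def J_D_diagonal)

text \<open>
  Since \<open>Q\<^sub>a(X,a) = 3 N D(X,a,a)\<close> with \<open>N = det a\<close>, the second summand of \<open>\<Phi>\<^sub>a\<close> collapses to
  \<open>- 3 N\<^sup>3 D(X,Y,a) a\<close>, and \<open>\<Phi>\<^sub>a\<close> is divisible by \<open>N\<^sup>3\<close>. This division brings the
  degree of \<open>T\<^sub>a\<close> down to 6.
\<close>

lemma isotope_mult_eq:
  assumes "J_det A a \<noteq> 0"
  shows "isotope_mult A a X Y = inverse (J_det A a) *s isotope_product a X Y"
proof -
  let ?N = "J_det A a"
  have Qa: "Q a X a = 3 * ?N * J_D A X a a" for X
    by (simp add: Q_def J_D_diagonal algebra_simps)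
  have "?N\<^sup>2 * Q a X Y - Q a X a * Q a Y a = 2 * - (?N ^ 3 * (3 * J_D A X Y a))"
    unfolding Qa
    by (simp add: Q_def J_D_diagonal algebra_simps power2_eq_square power3_eq_cube)
  then have half: "1 / 2 * (?N\<^sup>2 * Q a X Y - Q a X a * Q a Y a) = - (?N ^ 3 * (3 * J_D A X Y a))"
    using two by simp
  have "J_Phi A a X Y = ?N ^ 3 *s isotope_product a X Y"
    unfolding J_Phi_def J_Q_eq half by (simp add: isotope_product_def vec_eq_iff algebra_simps)
  moreover have "inverse (?N ^ 4) * ?N ^ 3 = inverse ?N"
    using assms by (simp add: field_simps power_Suc[symmetric] eval_nat_numeral)
  ultimately show ?thesis
    by (simp add: isotope_mult_def)
qed

lemma isotope_mult_iff:
  assumes "J_det A a \<noteq> 0"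
  shows "(\<forall>Z. J_Q A a W Z = inverse (J_det A a) * trace_form (J_D A) a X Y Z)
    \<longleftrightarrow> W = isotope_mult A a X Y"
proof -
  have *: "Q a (isotope_mult A a X Y) Z = inverse (J_det A a) * trace_form (J_D A) a X Y Z" for Z
    by (simp add: isotope_mult_eq[OF assms] Q_scale Q_isotope_product)
  show ?thesis
  proof
    assume "\<forall>Z. J_Q A a W Z = inverse (J_det A a) * trace_form (J_D A) a X Y Z"
    then have "Q a (W - isotope_mult A a X Y) Z = 0" for Z
      by (simp add: J_Q_eq Q_diff *)
    then have "W - isotope_mult A a X Y = 0"
      using assms by (intro Q_nondegenerate[of a]) (simp_all add: J_D_diagonal)
    then show "W = isotope_mult A a X Y"
      by simp
  qed (simp add: J_Q_eq *)
qed

end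

theorem theorem1p2:
  fixes A :: "('k :: field) oct"
  assumes "CHAR('k) \<noteq> 2" and "CHAR('k) \<noteq> 3"
    and "octonion_algebra A"
  shows "\<exists>T :: J_index \<Rightarrow> J_index \<Rightarrow> J_index \<Rightarrow> (J_index, 'k) mpoly.
    (\<forall>i j l. mpoly_homogeneous 6 (T i j l)) \<and>
    GE6_equivariant A T \<and>
    (\<forall>a. J_det A a \<noteq> 0 \<longrightarrow> (\<forall>X Y W.
       (\<forall>Z. J_Q A a W Z = inverse (J_det A a) * J_trilinear id T a X Y Z)
         \<longleftrightarrow> W = isotope_mult A a X Y))"
proof -
  interpret octonions A
    by unfold_locales (use assms field_char_not_2_3 in auto)
  have "J_trilinear id (trace_form_poly A) a X Y Z = trace_form (J_D A) a X Y Z" for a X Y Z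
    by (simp add: J_trilinear_trace_form_poly[OF ring_morphism_id] J_D_over_id)
  then show ?thesis
    using homogeneous_trace_form_poly GE6_equivariant_trace_form_poly isotope_mult_iff
    by (intro exI[of _ "trace_form_poly A"]) simp
qed

end
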